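(* For each $n\ge 1$ there is a constant $c>0$ depending only on $n$ so that for all $d\geq 1$ $$c^{-1}\,d^n\leq \dim\mathcal{P}_d(\mathbb{R}^n)\leq c\,d^n.$$
   Context: For $d>0$, $\mathcal{P}_d(\mathbb{R}^n)$ is the real vector space of smooth ancient solutions $u:\mathbb{R}^n\times(-\infty,0]\to\mathbb{R}$ of the heat equation $\partial_t u=\Delta u$ (with $\Delta$ the Euclidean Laplacian) such that for some $p\in\mathbb{R}^n$ and a constant $C_u$ depending on $u$, $\sup_{B_R(p)\times[-R^2,0]}|u|\leq C_u(1+R)^d$ for all $R>0$, where $B_R(p)$ is the Euclidean ball of radius $R$ about $p$. *)

theory Defs
  imports "HOL-Analysis.Analysis" "HOL-Library.Function_Algebras"
begin

(* Pointwise real vector space structure on functions; it makes the library's span, subspace and dim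
   available for spaces of functions. *)
instantiation "fun" :: (type, real_vector) real_vector
begin

definition scaleR_fun_def: "scaleR c f = (\<lambda>x. c *\<^sub>R f x)"

instance
  by standard (auto simp: scaleR_fun_def fun_eq_iff algebra_simps)

end

text \<open>Differentiability relative to a set \<open>S\<close>. The space-time domain
  \<open>UNIV \<times> {..0}\<close> below is convex with nonempty interior, so there the derivative within \<open>S\<close>
  is unique, and at \<open>t = 0\<close> it is one-sided in time: a function is smooth on
  the domain iff it has continuous derivatives of all orders up to and including the boundary.\<close>

primrec C_k_on :: "nat \<Rightarrow> 'a::real_normed_vector set \<Rightarrow> ('a \<Rightarrow> 'b::real_normed_vector) \<Rightarrow> bool" where
  "C_k_on 0 S f \<longleftrightarrow> continuous_on S f"
| "C_k_on (Suc k) S f \<longleftrightarrow>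
     (\<exists>f'. (\<forall>z\<in>S. (f has_derivative f' z) (at z within S)) \<and> (\<forall>v. C_k_on k S (\<lambda>z. f' z v)))"

definition smooth_on :: "'a::real_normed_vector set \<Rightarrow> ('a \<Rightarrow> 'b::real_normed_vector) \<Rightarrow> bool" where
  "smooth_on S f \<longleftrightarrow> (\<forall>k. C_k_on k S f)"

definition laplacian :: "('a::euclidean_space \<Rightarrow> real) \<Rightarrow> 'a \<Rightarrow> real" where
  "laplacian f x = (\<Sum>b\<in>Basis. (deriv ^^ 2) (\<lambda>s. f (x + s *\<^sub>R b)) 0)"

definition ancient_domain :: "('a::euclidean_space \<times> real) set" where
  "ancient_domain = UNIV \<times> {..0}"

definition ancient_caloric :: "('a::euclidean_space \<times> real \<Rightarrow> real) \<Rightarrow> bool" where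
  "ancient_caloric u \<longleftrightarrow> smooth_on ancient_domain u \<and>
     (\<forall>x. \<forall>t\<le>0. ((\<lambda>s. u (x, s)) has_real_derivative laplacian (\<lambda>y. u (y, t)) x) (at t within {..0}))"

(* HOL functions are total, so a function on ancient_domain is represented by its extension by 0;
   without this normalisation the values at positive times would add spurious dimensions. *)
definition ancient_caloric_poly :: "real \<Rightarrow> ('a::euclidean_space \<times> real \<Rightarrow> real) set" where
  "ancient_caloric_poly d = {u. (\<forall>z. z \<notin> ancient_domain \<longrightarrow> u z = 0) \<and> ancient_caloric u \<and>
     (\<exists>p C. \<forall>R>0. \<forall>x\<in>ball p R. \<forall>t\<in>{-(R^2)..0}. \<bar>u (x, t)\<bar> \<le> C * (1 + R) powr d)}"

(* The library's dim is 0 on infinite-dimensional spaces, so finiteness has to be asserted separately. *)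
definition finite_dimensional :: "'v::real_vector set \<Rightarrow> bool" where
  "finite_dimensional V \<longleftrightarrow> (\<exists>B. finite B \<and> V \<subseteq> span B)"

end

theory Submission
  imports Defs "HOL-Computational_Algebra.Polynomial"
begin

text \<open>
  Both bounds compare the space with the values of its elements on a grid
  \<open>{0, ..., k - 1}\<^sup>n\<close> in the time slice \<open>t = 0\<close>.

  Upper bound. The key is the interior gradient estimate \<open>gradient_estimate\<close>: a space derivative of a
  caloric function at a point is at most a constant times \<open>1 / R\<close> times the supremum of the function
  over a parabolic region of radius \<open>R\<close> below that point. It is proved by Bernstein's method, that is, by the maximum
  principle for an auxiliary function. A derivative of a caloric function is
  again caloric (\<open>caloric_dir_deriv\<close>), so each space derivative lowers the order of growth by one and each
  time derivative lowers it by two. A function of negative order of growth is zero. Therefore, if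
  \<open>k > d\<close>, all pure space derivatives of order \<open>k\<close> of an element of the space of order \<open>d\<close> vanish, and its
  restriction to \<open>t = 0\<close> is a polynomial of degree less than \<open>k\<close> in each variable, determined by its values
  on the grid. The restriction in turn determines the function: the heat equation expresses its time derivatives at
  \<open>t = 0\<close> through space derivatives, and the function is polynomial in time (\<open>caloric_zero_initial\<close>). Hence evaluation on the grid is injective and
  the dimension is at most \<open>k\<^sup>n\<close> (\<open>ancient_caloric_poly_finite_basis\<close>).

  Lower bound. Every polynomial \<open>p\<close> in one variable of degree at most \<open>m\<close> extends to the caloric polynomial
  \<open>exp (t d\<^sup>2/ds\<^sup>2) p\<close> of order of growth \<open>m\<close>. Products over the coordinates are caloric of
  order \<open>n m\<close>, and starting from Lagrange polynomials they realise every set of values on the grid with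
  \<open>m + 1\<close> points per direction (\<open>ancient_caloric_poly_large_independent\<close>). With \<open>m\<close> the integer part of \<open>d / n\<close>
  this gives dimension at least \<open>(d / n)\<^sup>n\<close>.
\<close>

section \<open>Smooth functions relative to a set\<close>

lemma C_k_on_cong:
  assumes "C_k_on k S f" "\<And>z. z \<in> S \<Longrightarrow> f z = g z"
  shows "C_k_on k S g"
proof (cases k)
  case 0
  then show ?thesis using assms continuous_on_cong[of S S f g] by simp
next
  case (Suc m)
  with assms(1) obtain f' where f': "\<forall>z\<in>S. (f has_derivative f' z) (at z within S)"
      "\<forall>v. C_k_on m S (\<lambda>z. f' z v)" by auto
  have "\<forall>z\<in>S. (g has_derivative f' z) (at z within S)"
    using f'(1) assms(2) by (metis has_derivative_transform)
  then show ?thesis using Suc f'(2) by auto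
qed

lemma C_k_on_continuous: "C_k_on k S f \<Longrightarrow> continuous_on S f"
  by (cases k) (auto intro: has_derivative_continuous_on)

lemma C_k_on_Suc_imp: "C_k_on (Suc k) S f \<Longrightarrow> C_k_on k S f"
proof (induction k arbitrary: f)
  case 0
  then show ?case using C_k_on_continuous by fastforce
next
  case (Suc k)
  then obtain f' where "\<forall>z\<in>S. (f has_derivative f' z) (at z within S)"
      "\<forall>v. C_k_on (Suc k) S (\<lambda>z. f' z v)" by auto
  then show ?case using Suc.IH by auto
qed

lemma C_k_on_const: "C_k_on k S (\<lambda>z. c)"
proof (induction k arbitrary: c)
  case (Suc k)
  then show ?case by (auto intro!: exI[of _ "\<lambda>z v. 0"])
qed auto

lemma C_k_on_bounded_linear: "bounded_linear f \<Longrightarrow> C_k_on k S f"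
  by (cases k) (auto simp: linear_continuous_on bounded_linear_imp_has_derivative C_k_on_const
      intro!: exI[of _ "\<lambda>z. f"])

lemma C_k_on_add:
  "C_k_on k S f \<Longrightarrow> C_k_on k S g \<Longrightarrow> C_k_on k S (\<lambda>z. f z + g z)"
proof (induction k arbitrary: f g)
  case 0
  then show ?case by (simp add: continuous_on_add)
next
  case (Suc k)
  then obtain f' g' where "\<forall>z\<in>S. (f has_derivative f' z) (at z within S)"
      "\<forall>v. C_k_on k S (\<lambda>z. f' z v)" "\<forall>z\<in>S. (g has_derivative g' z) (at z within S)"
      "\<forall>v. C_k_on k S (\<lambda>z. g' z v)" by auto
  then show ?case using Suc.IH
    by (auto intro!: exI[of _ "\<lambda>z v. f' z v + g' z v"] has_derivative_add)
qed

lemma C_k_on_mult: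
  fixes f g :: "'a::real_normed_vector \<Rightarrow> real"
  shows "C_k_on k S f \<Longrightarrow> C_k_on k S g \<Longrightarrow> C_k_on k S (\<lambda>z. f z * g z)"
proof (induction k arbitrary: f g)
  case 0
  then show ?case by (simp add: continuous_on_mult)
next
  case (Suc k)
  then obtain f' g' where *: "\<forall>z\<in>S. (f has_derivative f' z) (at z within S)"
      "\<forall>v. C_k_on k S (\<lambda>z. f' z v)" "\<forall>z\<in>S. (g has_derivative g' z) (at z within S)"
      "\<forall>v. C_k_on k S (\<lambda>z. g' z v)" by auto
  have "C_k_on k S f" "C_k_on k S g" using Suc.prems C_k_on_Suc_imp by auto
  then show ?case using Suc.IH *
    by (auto intro!: exI[of _ "\<lambda>z v. f z * g' z v + f' z v * g z"] has_derivative_mult C_k_on_add)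
qed

lemma smooth_on_cong: "smooth_on S f \<Longrightarrow> (\<And>z. z \<in> S \<Longrightarrow> f z = g z) \<Longrightarrow> smooth_on S g"
  unfolding smooth_on_def using C_k_on_cong by blast

lemma smooth_on_const: "smooth_on S (\<lambda>z. c)"
  by (simp add: smooth_on_def C_k_on_const)

lemma smooth_on_bounded_linear: "bounded_linear f \<Longrightarrow> smooth_on S f"
  by (simp add: smooth_on_def C_k_on_bounded_linear)

lemma smooth_on_add: "smooth_on S f \<Longrightarrow> smooth_on S g \<Longrightarrow> smooth_on S (\<lambda>z. f z + g z)"
  by (simp add: smooth_on_def C_k_on_add)

lemma smooth_on_mult:
  fixes f g :: "'a::real_normed_vector \<Rightarrow> real"
  shows "smooth_on S f \<Longrightarrow> smooth_on S g \<Longrightarrow> smooth_on S (\<lambda>z. f z * g z)"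
  by (simp add: smooth_on_def C_k_on_mult)

lemma smooth_on_sum:
  assumes "\<And>i. i \<in> I \<Longrightarrow> smooth_on S (f i)"
  shows "smooth_on S (\<lambda>z. \<Sum>i\<in>I. f i z)"
  using assms by (induction I rule: infinite_finite_induct) (auto intro: smooth_on_const smooth_on_add)

lemma smooth_on_prod:
  fixes f :: "'i \<Rightarrow> 'a::real_normed_vector \<Rightarrow> real"
  assumes "\<And>i. i \<in> I \<Longrightarrow> smooth_on S (f i)"
  shows "smooth_on S (\<lambda>z. \<Prod>i\<in>I. f i z)"
  using assms by (induction I rule: infinite_finite_induct) (auto intro: smooth_on_const smooth_on_mult)

lemma smooth_on_power:
  fixes f :: "'a::real_normed_vector \<Rightarrow> real"
  shows "smooth_on S f \<Longrightarrow> smooth_on S (\<lambda>z. f z ^ n)"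
  by (induction n) (auto intro: smooth_on_const smooth_on_mult)

lemma smooth_on_poly:
  fixes f :: "'a::real_normed_vector \<Rightarrow> real"
  assumes "smooth_on S f"
  shows "smooth_on S (\<lambda>z. poly p (f z))"
proof (induction p)
  case (pCons a p)
  have "smooth_on S (\<lambda>z. a + f z * poly p (f z))"
    by (intro smooth_on_add smooth_on_const smooth_on_mult assms pCons)
  then show ?case by simp
qed (simp add: smooth_on_const)

section \<open>Directional derivatives on the space-time domain\<close>

text \<open>The derivative is taken within the domain, so at the boundary \<open>t = 0\<close> the time
  derivative is one-sided and all identities below hold up to and including the boundary.\<close>

definition dir_deriv ::
    "'a::euclidean_space \<times> real \<Rightarrow> ('a \<times> real \<Rightarrow> real) \<Rightarrow> 'a \<times> real \<Rightarrow> real" where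
  "dir_deriv v u z = frechet_derivative u (at z within ancient_domain) v"

lemma mem_ancient_domain [simp]: "(x, t) \<in> ancient_domain \<longleftrightarrow> t \<le> 0"
  by (simp add: ancient_domain_def)

text \<open>From every point of the domain a short step backwards along any basis vector stays
  in the domain; this is enough to pin down a linear approximation.\<close>

lemma derivative_unique_on_domain:
  fixes u :: "'a::euclidean_space \<times> real \<Rightarrow> real"
  assumes "z \<in> ancient_domain"
    "(u has_derivative f) (at z within ancient_domain)"
    "(u has_derivative g) (at z within ancient_domain)"
  shows "f = g"
proof (rule frechet_derivative_unique_within[OF assms(2,3)])
  fix i :: "'a \<times> real" and e :: real
  assume i: "i \<in> Basis" "e > 0"
  obtain x t where z: "z = (x, t)" "t \<le> 0" using assms(1) by (cases z) auto
  have "z + (- (e/2)) *\<^sub>R i \<in> ancient_domain"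
    using i z by (auto simp: Basis_prod_def)
  with i show "\<exists>d. 0 < \<bar>d\<bar> \<and> \<bar>d\<bar> < e \<and> z + d *\<^sub>R i \<in> ancient_domain"
    by (intro exI[of _ "- (e/2)"]) auto
qed

lemma dir_deriv_eqI:
  assumes "z \<in> ancient_domain" "(u has_derivative f) (at z within ancient_domain)"
  shows "dir_deriv v u z = f v"
  using derivative_unique_on_domain[OF assms(1) assms(2)] assms(2) frechet_derivative_works
  unfolding dir_deriv_def differentiable_def by metis

lemma smooth_on_has_derivative:
  assumes "smooth_on ancient_domain u" "z \<in> ancient_domain"
  shows "(u has_derivative (\<lambda>v. dir_deriv v u z)) (at z within ancient_domain)"
proof -
  have "C_k_on (Suc 0) ancient_domain u" using assms(1) by (auto simp only: smooth_on_def)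
  then obtain f' where "(u has_derivative f') (at z within ancient_domain)"
    using assms(2) by auto
  moreover have "f' = (\<lambda>v. dir_deriv v u z)" using dir_deriv_eqI[OF assms(2) calculation] by auto
  ultimately show ?thesis by simp
qed

lemma smooth_on_dir_deriv:
  assumes "smooth_on ancient_domain u"
  shows "smooth_on ancient_domain (dir_deriv v u)"
  unfolding smooth_on_def
proof
  fix k
  have "C_k_on (Suc k) ancient_domain u" using assms by (auto simp only: smooth_on_def)
  then obtain f' where *: "\<forall>z\<in>ancient_domain. (u has_derivative f' z) (at z within ancient_domain)"
      "\<forall>v. C_k_on k ancient_domain (\<lambda>z. f' z v)" unfolding C_k_on.simps by blast
  have "dir_deriv v u z = f' z v" if "z \<in> ancient_domain" for z
    using dir_deriv_eqI[OF that] *(1) that by blast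
  then show "C_k_on k ancient_domain (dir_deriv v u)"
    using C_k_on_cong[OF *(2)[rule_format, of v]] by metis
qed

lemma smooth_on_imp_continuous_on: "smooth_on S u \<Longrightarrow> continuous_on S u"
  using C_k_on_continuous smooth_on_def by blast

lemma dir_deriv_cong:
  assumes "z \<in> ancient_domain" "smooth_on ancient_domain u"
    "\<And>z. z \<in> ancient_domain \<Longrightarrow> u z = w z"
  shows "dir_deriv v u z = dir_deriv v w z"
proof -
  have "(w has_derivative (\<lambda>v. dir_deriv v u z)) (at z within ancient_domain)"
    using smooth_on_has_derivative[OF assms(2,1)] assms(1,3) by (metis has_derivative_transform)
  from dir_deriv_eqI[OF assms(1) this] show ?thesis by simp
qed

lemma dir_deriv_uminus:
  assumes "smooth_on ancient_domain u" "z \<in> ancient_domain"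
  shows "dir_deriv (- v) u z = - dir_deriv v u z"
  using linear_neg[OF has_derivative_linear[OF smooth_on_has_derivative[OF assms]]] .

lemma dir_deriv_minus_function:
  assumes "smooth_on ancient_domain u" "z \<in> ancient_domain"
  shows "dir_deriv v (\<lambda>z. - u z) z = - dir_deriv v u z"
  by (rule dir_deriv_eqI[OF assms(2)]) (intro has_derivative_minus smooth_on_has_derivative assms)

lemma dir_deriv_sum:
  assumes "\<And>i. i \<in> I \<Longrightarrow> smooth_on ancient_domain (u i)" "z \<in> ancient_domain"
  shows "dir_deriv v (\<lambda>z. \<Sum>i\<in>I. u i z) z = (\<Sum>i\<in>I. dir_deriv v (u i) z)"
  by (rule dir_deriv_eqI[OF assms(2)]) (intro has_derivative_sum smooth_on_has_derivative assms)

lemma dir_deriv_lincomb: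
  assumes "smooth_on ancient_domain u" "smooth_on ancient_domain w" "z \<in> ancient_domain"
  shows "dir_deriv v (\<lambda>z. u z + c * w z) z = dir_deriv v u z + c * dir_deriv v w z"
  by (rule dir_deriv_eqI[OF assms(3)])
    (intro has_derivative_add has_derivative_mult_right smooth_on_has_derivative assms)

lemma dir_deriv_along_line:
  assumes u: "smooth_on ancient_domain u" and s: "s \<in> J"
    and J: "\<And>r. r \<in> J \<Longrightarrow> z + r *\<^sub>R v \<in> ancient_domain"
  shows "((\<lambda>r. u (z + r *\<^sub>R v)) has_real_derivative dir_deriv v u (z + s *\<^sub>R v)) (at s within J)"
proof -
  let ?g = "\<lambda>r. z + r *\<^sub>R v" and ?D = "\<lambda>w. dir_deriv w u (z + s *\<^sub>R v)"
  have "(u has_derivative ?D) (at (?g s) within ?g ` J)"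
    by (rule has_derivative_subset[OF smooth_on_has_derivative[OF u J[OF s]]]) (use J in auto)
  moreover have "(?g has_derivative (\<lambda>h. h *\<^sub>R v)) (at s within J)"
    by (auto intro!: derivative_eq_intros)
  ultimately have "(u \<circ> ?g has_derivative ?D \<circ> (\<lambda>h. h *\<^sub>R v)) (at s within J)"
    by (intro diff_chain_within)
  moreover have "?D \<circ> (\<lambda>h. h *\<^sub>R v) = (*) (?D v)"
    using linear_scale[OF has_derivative_linear[OF smooth_on_has_derivative[OF u J[OF s]]]]
    by (auto simp: fun_eq_iff mult.commute)
  ultimately show ?thesis by (simp add: has_field_derivative_def o_def)
qed

lemma dir_deriv_space:
  assumes "smooth_on ancient_domain u" "t \<le> 0"
  shows "((\<lambda>r. u (x + r *\<^sub>R b, t)) has_real_derivative dir_deriv (b, 0) u (x + s *\<^sub>R b, t)) (at s)"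
  using dir_deriv_along_line[OF assms(1), of s UNIV "(x, t)" "(b, 0)"] assms(2) by simp

lemma dir_deriv_time:
  assumes "smooth_on ancient_domain u" "t \<le> 0"
  shows "((\<lambda>r. u (x, r)) has_real_derivative dir_deriv (0, 1) u (x, t)) (at t within {..0})"
  using dir_deriv_along_line[OF assms(1), of t "{..0}" "(x, 0)" "(0, 1)"] assms(2) by simp

text \<open>Two applications of the mean value theorem, first along \<open>v\<close> and then along \<open>w\<close>. The left-hand
  side is symmetric in \<open>v\<close> and \<open>w\<close>, which yields the symmetry of second derivatives in the limit
  \<open>h \<rightarrow> 0\<close>. Directions that do not point to the future never leave the domain, so boundary points
  need no separate treatment.\<close>

lemma second_difference:
  assumes u: "smooth_on ancient_domain u" and z: "z \<in> ancient_domain" and h: "h \<ge> 0"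
    and v: "snd v \<le> 0" and w: "snd w \<le> 0"
  shows "\<exists>a\<in>{0..h}. \<exists>b\<in>{0..h}. u (z + h *\<^sub>R v + h *\<^sub>R w) - u (z + h *\<^sub>R v) - u (z + h *\<^sub>R w) + u z
     = h * h * dir_deriv w (dir_deriv v u) (z + a *\<^sub>R v + b *\<^sub>R w)"
proof -
  have dom: "z + a *\<^sub>R v + b *\<^sub>R w \<in> ancient_domain" if "a \<ge> 0" "b \<ge> 0" for a b
    using z v w that by (cases z, cases v, cases w) (auto simp: add_nonpos_nonpos mult_nonneg_nonpos)
  let ?p = "\<lambda>r. u (z + h *\<^sub>R w + r *\<^sub>R v) - u (z + r *\<^sub>R v)"
  have d: "z + r *\<^sub>R v \<in> ancient_domain" "z + h *\<^sub>R w + r *\<^sub>R v \<in> ancient_domain" if "r \<in> {0..h}" for r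
    using dom[of r 0] dom[of r h] h that by (auto simp: algebra_simps)
  have "(?p has_derivative (*) (dir_deriv v u (z + h *\<^sub>R w + s *\<^sub>R v) - dir_deriv v u (z + s *\<^sub>R v)))
      (at s within {0..h})" if "0 \<le> s" "s \<le> h" for s
    using d that unfolding has_field_derivative_def[symmetric]
    by (intro DERIV_diff dir_deriv_along_line u) auto
  from mvt_very_simple[OF h this] obtain a where a: "a \<in> {0..h}"
    "?p h - ?p 0 = h * (dir_deriv v u (z + h *\<^sub>R w + a *\<^sub>R v) - dir_deriv v u (z + a *\<^sub>R v))"
    by (auto simp: mult.commute)
  let ?q = "\<lambda>r. dir_deriv v u (z + a *\<^sub>R v + r *\<^sub>R w)"
  have "(?q has_derivative (*) (dir_deriv w (dir_deriv v u) (z + a *\<^sub>R v + s *\<^sub>R w)))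
      (at s within {0..h})" if "0 \<le> s" "s \<le> h" for s
    using dom a(1) that unfolding has_field_derivative_def[symmetric]
    by (intro dir_deriv_along_line smooth_on_dir_deriv u) auto
  from mvt_very_simple[OF h this] obtain b where b: "b \<in> {0..h}"
    "?q h - ?q 0 = h * dir_deriv w (dir_deriv v u) (z + a *\<^sub>R v + b *\<^sub>R w)"
    by (auto simp: mult.commute)
  have "?p h - ?p 0 = h * (?q h - ?q 0)" using a(2) by (simp add: algebra_simps)
  with a(1) b show ?thesis
    by (intro bexI[of _ a] bexI[of _ b]) (auto simp: algebra_simps)
qed

lemma dir_deriv_commute_past:
  fixes u :: "'a::euclidean_space \<times> real \<Rightarrow> real"
  assumes u: "smooth_on ancient_domain u" and z: "z \<in> ancient_domain"
    and v: "snd v \<le> 0" and w: "snd w \<le> 0"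
  shows "dir_deriv v (dir_deriv w u) z = dir_deriv w (dir_deriv v u) z"
proof -
  let ?h = "\<lambda>n. 1 / real (Suc n)"
  have *: "\<exists>c. (\<forall>n. c n \<in> {0..?h n} \<times> {0..?h n} \<and>
      u (z + ?h n *\<^sub>R v + ?h n *\<^sub>R w) - u (z + ?h n *\<^sub>R v) - u (z + ?h n *\<^sub>R w) + u z
        = ?h n * ?h n * dir_deriv w (dir_deriv v u) (z + fst (c n) *\<^sub>R v + snd (c n) *\<^sub>R w)) \<and>
      (\<lambda>n. dir_deriv w (dir_deriv v u) (z + fst (c n) *\<^sub>R v + snd (c n) *\<^sub>R w))
        \<longlonglongrightarrow> dir_deriv w (dir_deriv v u) z"
    if v: "snd v \<le> 0" and w: "snd w \<le> 0" for v w
  proof -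
    have "\<exists>c. c \<in> {0..?h n} \<times> {0..?h n} \<and>
      u (z + ?h n *\<^sub>R v + ?h n *\<^sub>R w) - u (z + ?h n *\<^sub>R v) - u (z + ?h n *\<^sub>R w) + u z
        = ?h n * ?h n * dir_deriv w (dir_deriv v u) (z + fst c *\<^sub>R v + snd c *\<^sub>R w)" for n
      using second_difference[OF u z _ v w, of "?h n"] by fastforce
    then obtain c where c: "\<And>n. c n \<in> {0..?h n} \<times> {0..?h n}" 
      "\<And>n. u (z + ?h n *\<^sub>R v + ?h n *\<^sub>R w) - u (z + ?h n *\<^sub>R v) - u (z + ?h n *\<^sub>R w) + u z
        = ?h n * ?h n * dir_deriv w (dir_deriv v u) (z + fst (c n) *\<^sub>R v + snd (c n) *\<^sub>R w)"
      by metis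
    have h0: "?h \<longlonglongrightarrow> 0" using LIMSEQ_inverse_real_of_nat by (simp add: inverse_eq_divide)
    have "(\<lambda>n. fst (c n)) \<longlonglongrightarrow> 0" "(\<lambda>n. snd (c n)) \<longlonglongrightarrow> 0"
      by (rule tendsto_sandwich[OF _ _ tendsto_const h0];
          use c(1) in \<open>auto simp: mem_Times_iff\<close>)+
    then have "(\<lambda>n. z + fst (c n) *\<^sub>R v + snd (c n) *\<^sub>R w) \<longlonglongrightarrow> z + 0 *\<^sub>R v + 0 *\<^sub>R w"
      by (intro tendsto_intros)
    moreover have "z + fst (c n) *\<^sub>R v + snd (c n) *\<^sub>R w \<in> ancient_domain" for n
      using z v w c(1)[of n]
      by (cases z, cases v, cases w) (auto simp: add_nonpos_nonpos mult_nonneg_nonpos mem_Times_iff)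
    moreover have "continuous_on ancient_domain (dir_deriv w (dir_deriv v u))"
      by (intro smooth_on_imp_continuous_on smooth_on_dir_deriv u)
    ultimately have "(\<lambda>n. dir_deriv w (dir_deriv v u) (z + fst (c n) *\<^sub>R v + snd (c n) *\<^sub>R w))
        \<longlonglongrightarrow> dir_deriv w (dir_deriv v u) z"
      using z unfolding continuous_on_sequentially o_def by simp
    with c show ?thesis by blast
  qed
  obtain c where c: "\<And>n. u (z + ?h n *\<^sub>R v + ?h n *\<^sub>R w) - u (z + ?h n *\<^sub>R v) - u (z + ?h n *\<^sub>R w) + u z
        = ?h n * ?h n * dir_deriv w (dir_deriv v u) (z + fst (c n) *\<^sub>R v + snd (c n) *\<^sub>R w)"
      "(\<lambda>n. dir_deriv w (dir_deriv v u) (z + fst (c n) *\<^sub>R v + snd (c n) *\<^sub>R w))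
        \<longlonglongrightarrow> dir_deriv w (dir_deriv v u) z"
    using *[OF v w] by blast
  obtain e where e: "\<And>n. u (z + ?h n *\<^sub>R w + ?h n *\<^sub>R v) - u (z + ?h n *\<^sub>R w) - u (z + ?h n *\<^sub>R v) + u z
        = ?h n * ?h n * dir_deriv v (dir_deriv w u) (z + fst (e n) *\<^sub>R w + snd (e n) *\<^sub>R v)"
      "(\<lambda>n. dir_deriv v (dir_deriv w u) (z + fst (e n) *\<^sub>R w + snd (e n) *\<^sub>R v))
        \<longlonglongrightarrow> dir_deriv v (dir_deriv w u) z"
    using *[OF w v] by blast
  have "dir_deriv w (dir_deriv v u) (z + fst (c n) *\<^sub>R v + snd (c n) *\<^sub>R w) =
      dir_deriv v (dir_deriv w u) (z + fst (e n) *\<^sub>R w + snd (e n) *\<^sub>R v)" for n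
  proof -
    have eq: "z + ?h n *\<^sub>R w + ?h n *\<^sub>R v = z + ?h n *\<^sub>R v + ?h n *\<^sub>R w" by (simp add: algebra_simps)
    then have "?h n * ?h n * dir_deriv w (dir_deriv v u) (z + fst (c n) *\<^sub>R v + snd (c n) *\<^sub>R w) =
        ?h n * ?h n * dir_deriv v (dir_deriv w u) (z + fst (e n) *\<^sub>R w + snd (e n) *\<^sub>R v)"
      using c(1)[of n] e(1)[of n] unfolding eq by linarith
    then show ?thesis by simp
  qed
  with c(2) e(2) show ?thesis using LIMSEQ_unique by auto
qed

text \<open>Every direction points to the past up to sign, and directional derivatives are odd in the
  direction.\<close>

lemma dir_deriv_commute:
  fixes u :: "'a::euclidean_space \<times> real \<Rightarrow> real"
  assumes u: "smooth_on ancient_domain u" and z: "z \<in> ancient_domain"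
  shows "dir_deriv v (dir_deriv w u) z = dir_deriv w (dir_deriv v u) z"
proof -
  have flip: "dir_deriv v (dir_deriv (- w) u) z = - dir_deriv v (dir_deriv w u) z"
    for v w :: "'a \<times> real"
  proof -
    have "dir_deriv v (dir_deriv (- w) u) z = dir_deriv v (\<lambda>z. - dir_deriv w u z) z"
      by (rule dir_deriv_cong[OF z]) (auto simp: dir_deriv_uminus u smooth_on_dir_deriv)
    then show ?thesis by (simp add: dir_deriv_minus_function smooth_on_dir_deriv u z)
  qed
  have *: "dir_deriv v (dir_deriv w u) z = dir_deriv w (dir_deriv v u) z" if "snd w \<le> 0" for v w
  proof (cases "snd v \<le> 0")
    case True
    then show ?thesis using that dir_deriv_commute_past[OF u z] by auto
  next
    case False
    then have "dir_deriv (- v) (dir_deriv w u) z = dir_deriv w (dir_deriv (- v) u) z"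
      using that dir_deriv_commute_past[OF u z, of "- v" w] by auto
    then show ?thesis by (simp add: flip dir_deriv_uminus smooth_on_dir_deriv u z)
  qed
  show ?thesis
    using *[of w v] *[of "- w" v]
    by (cases "snd w \<le> 0") (auto simp: flip dir_deriv_uminus smooth_on_dir_deriv u z)
qed

section \<open>Caloric functions and the gradient estimate\<close>

text \<open>The heat equation in terms of iterated directional derivatives. In this form it can be
  differentiated; it agrees with the defining notion by \<open>ancient_caloric_iff\<close>.\<close>

definition caloric :: "('a::euclidean_space \<times> real \<Rightarrow> real) \<Rightarrow> bool" where
  "caloric u \<longleftrightarrow> smooth_on ancient_domain u \<and> (\<forall>z\<in>ancient_domain.
     dir_deriv (0, 1) u z = (\<Sum>b\<in>Basis. dir_deriv (b, 0) (dir_deriv (b, 0) u) z))"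

lemma caloric_imp_smooth_on: "caloric u \<Longrightarrow> smooth_on ancient_domain u"
  by (simp add: caloric_def)

text \<open>The heat equation has constant coefficients, and directional derivatives commute.\<close>

lemma caloric_dir_deriv:
  fixes u :: "'a::euclidean_space \<times> real \<Rightarrow> real"
  assumes "caloric u"
  shows "caloric (dir_deriv v u)"
  unfolding caloric_def
proof (intro conjI ballI)
  have u: "smooth_on ancient_domain u" using assms by (rule caloric_imp_smooth_on)
  note smooth = u smooth_on_dir_deriv smooth_on_sum
  show "smooth_on ancient_domain (dir_deriv v u)" by (intro smooth)
  fix z :: "'a \<times> real" assume z: "z \<in> ancient_domain"
  have "dir_deriv (0, 1) (dir_deriv v u) z = dir_deriv v (dir_deriv (0, 1) u) z"
    by (rule dir_deriv_commute[OF u z])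
  also have "\<dots> = dir_deriv v (\<lambda>z. \<Sum>b\<in>Basis. dir_deriv (b, 0) (dir_deriv (b, 0) u) z) z"
    by (rule dir_deriv_cong[OF z]) (use assms smooth in \<open>auto simp: caloric_def\<close>)
  also have "\<dots> = (\<Sum>b\<in>Basis. dir_deriv v (dir_deriv (b, 0) (dir_deriv (b, 0) u)) z)"
    by (rule dir_deriv_sum[OF _ z]) (intro smooth)
  also have "\<dots> = (\<Sum>b\<in>Basis. dir_deriv (b, 0) (dir_deriv (b, 0) (dir_deriv v u)) z)"
  proof (rule sum.cong[OF refl])
    fix b :: 'a
    have "dir_deriv v (dir_deriv (b, 0) (dir_deriv (b, 0) u)) z
        = dir_deriv (b, 0) (dir_deriv v (dir_deriv (b, 0) u)) z"
      by (rule dir_deriv_commute[OF _ z]) (intro smooth)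
    also have "\<dots> = dir_deriv (b, 0) (dir_deriv (b, 0) (dir_deriv v u)) z"
      by (rule dir_deriv_cong[OF z]) (intro smooth dir_deriv_commute[OF u])+
    finally show "dir_deriv v (dir_deriv (b, 0) (dir_deriv (b, 0) u)) z
        = dir_deriv (b, 0) (dir_deriv (b, 0) (dir_deriv v u)) z" .
  qed
  finally show "dir_deriv (0, 1) (dir_deriv v u) z
      = (\<Sum>b\<in>Basis. dir_deriv (b, 0) (dir_deriv (b, 0) (dir_deriv v u)) z)" .
qed

lemma caloric_funpow_dir_deriv: "caloric u \<Longrightarrow> caloric ((dir_deriv v ^^ k) u)"
  by (induction k) (auto intro: caloric_dir_deriv)

lemma second_derivative_nonpos_at_max:
  fixes f f' :: "real \<Rightarrow> real"
  assumes f: "\<And>s. (f has_real_derivative f' s) (at s)" and f': "(f' has_real_derivative l) (at 0)"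
    and d: "d > 0" and max: "\<And>s. \<bar>s\<bar> < d \<Longrightarrow> f s \<le> f 0"
  shows "l \<le> 0"
proof (rule ccontr)
  assume "\<not> l \<le> 0"
  then obtain e where e: "e > 0" "\<And>s. 0 < s \<Longrightarrow> s < e \<Longrightarrow> f' 0 < f' s"
    using DERIV_pos_inc_right[OF f'] by auto
  have "f' 0 = 0" using DERIV_local_max[OF f d] max by auto
  then have pos: "f' s > 0" if "0 < s" "s < e" for s using e(2)[OF that] by simp
  define r where "r = min d e / 2"
  have r: "0 < r" "r < d" "r < e" using d e(1) by (auto simp: r_def)
  have "f 0 < f r"
  proof (rule DERIV_pos_imp_increasing_open[OF r(1)])
    show "\<exists>y. (f has_real_derivative y) (at s) \<and> 0 < y" if "0 < s" "s < r" for s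
      using f pos[of s] that r by auto
    show "continuous_on {0..r} f"
      using f by (meson DERIV_isCont continuous_at_imp_continuous_on)
  qed
  then show False using max[of r] r by auto
qed

lemma bernstein_function_derivative:
  fixes e f g :: "real \<Rightarrow> real"
  assumes "(e has_real_derivative e') (at t within S)" "(f has_real_derivative f') (at t within S)"
    "(g has_real_derivative g') (at t within S)"
  shows "((\<lambda>r. (e r * g r)\<^sup>2 + L * (f r)\<^sup>2) has_real_derivative
    2 * (e t * g t) * (e' * g t + e t * g') + 2 * L * (f t * f')) (at t within S)"
  by (rule derivative_eq_intros assms refl)+ (simp add: algebra_simps power2_eq_square)

text \<open>The inequality that Bernstein's auxiliary function \<open>h\<^sup>2 g\<^sup>2 + L f\<^sup>2\<close> satisfies along a line at a
  maximum. Its second derivative there is nonpositive. The mixed term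
  \<open>8 h h' g g'\<close> is absorbed into \<open>2 h\<^sup>2 g'\<^sup>2\<close> by completing a square, at the price of \<open>8 h'\<^sup>2 g\<^sup>2\<close>; what is
  left over contains only \<open>g g''\<close> and \<open>f f''\<close>, which the heat equation turns into time derivatives
  after summation over the coordinate directions.\<close>

lemma bernstein_line:
  fixes f f' g g' :: "real \<Rightarrow> real" and q y L :: real
  defines "h \<equiv> \<lambda>s. q - 2 * y * s - s\<^sup>2"
  assumes f: "\<And>s. (f has_real_derivative f' s) (at s)" "(f' has_real_derivative f2) (at 0)"
    and g: "\<And>s. (g has_real_derivative g' s) (at s)" "(g' has_real_derivative g2) (at 0)"
    and d: "d > 0"
    and max: "\<And>s. \<bar>s\<bar> < d \<Longrightarrow> (h s * g s)\<^sup>2 + L * (f s)\<^sup>2 \<le> (h 0 * g 0)\<^sup>2 + L * (f 0)\<^sup>2"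
  shows "q\<^sup>2 * (g 0 * g2) + L * (f 0 * f2) + L * (f' 0)\<^sup>2 \<le> 12 * (y\<^sup>2 * (g 0)\<^sup>2) + 2 * (q * (g 0)\<^sup>2)"
proof -
  let ?p = "\<lambda>s. (h s * g s)\<^sup>2 + L * (f s)\<^sup>2"
  let ?h' = "\<lambda>s. - 2 * y - 2 * s"
  let ?p' = "\<lambda>s. 2 * (h s * g s) * (?h' s * g s + h s * g' s) + 2 * L * (f s * f' s)"
  let ?l = "2 * (?h' 0 * g 0 + h 0 * g' 0)\<^sup>2
      + 2 * (h 0 * g 0) * (- 2 * g 0 + 2 * (?h' 0 * g' 0) + h 0 * g2) + 2 * L * ((f' 0)\<^sup>2 + f 0 * f2)"
  have h: "(h has_real_derivative ?h' s) (at s)" for s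
    unfolding h_def by (auto intro!: derivative_eq_intros)
  have "?l \<le> 0"
  proof (rule second_derivative_nonpos_at_max[OF _ _ d, of ?p ?p'])
    show "(?p has_real_derivative ?p' s) (at s)" for s
      by (intro bernstein_function_derivative h f g)
    show "(?p' has_real_derivative ?l) (at 0)"
      by (rule derivative_eq_intros h f g refl)+ (simp add: algebra_simps power2_eq_square)
  qed (use max in auto)
  moreover have "?l = 2 * (q * g' 0 - 4 * (y * g 0))\<^sup>2 - 24 * (y\<^sup>2 * (g 0)\<^sup>2) - 4 * (q * (g 0)\<^sup>2)
      + 2 * (q\<^sup>2 * (g 0 * g2)) + 2 * (L * (f' 0)\<^sup>2) + 2 * (L * (f 0 * f2))"
    by (simp add: h_def power2_eq_square) algebra
  ultimately show ?thesis using zero_le_power2[of "q * g' 0 - 4 * (y * g 0)"] by linarith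
qed

lemma derivative_nonneg_at_left_max:
  fixes f :: "real \<Rightarrow> real"
  assumes "(f has_real_derivative l) (at t within {..0})" "t \<le> 0" "d > 0"
    "\<And>s. t - d < s \<Longrightarrow> s \<le> t \<Longrightarrow> f s \<le> f t"
  shows "l \<ge> 0"
proof (rule ccontr)
  assume "\<not> l \<ge> 0"
  then obtain e where e: "e > 0" "\<And>h. h > 0 \<Longrightarrow> t - h \<in> {..0} \<Longrightarrow> h < e \<Longrightarrow> f t < f (t - h)"
    using has_real_derivative_neg_dec_left[OF assms(1)] by auto
  have "f t < f (t - min d e / 2)" using e assms by auto
  then show False using assms(3,4) e(1) by (smt (verit) field_sum_of_halves)
qed

text \<open>Bernstein's method. Let \<open>w\<close> be the derivative of \<open>u\<close> along \<open>b\<close>, and let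
  \<open>eta = R\<^sup>2 + (t - t0) - |x - x0|\<^sup>2\<close>, which is nonnegative on a compact solid paraboloid with top centre
  \<open>(x0, t0)\<close> and vanishes on its lateral boundary. Since \<open>w\<close> is caloric too, the heat operator applied to
  \<open>F = eta\<^sup>2 w\<^sup>2 + L u\<^sup>2\<close> is at most \<open>w\<^sup>2 (2 (2 n + 1) eta + 24 |x - x0|\<^sup>2 - 2 L)\<close>, where the last summand comes
  from \<open>- 2 L |grad u|\<^sup>2\<close>. With \<open>L = (14 + 2 n) R\<^sup>2\<close> this is negative wherever \<open>w \<noteq> 0\<close>, so at a maximum of
  \<open>F\<close> the first summand vanishes and \<open>F \<le> L M\<^sup>2\<close>. Evaluating \<open>F\<close> at \<open>(x0, t0)\<close>, where \<open>eta = R\<^sup>2\<close>,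
  gives the estimate.\<close>

lemma gradient_estimate:
  fixes u :: "'a::euclidean_space \<times> real \<Rightarrow> real" and M R :: real
  assumes u: "caloric u" and b: "b \<in> Basis" and t0: "t0 \<le> 0" and R: "R > 0"
    and bound: "\<And>x t. t \<le> t0 \<Longrightarrow> (norm (x - x0))\<^sup>2 \<le> R\<^sup>2 + (t - t0) \<Longrightarrow> \<bar>u (x, t)\<bar> \<le> M"
  shows "\<bar>dir_deriv (b, 0) u (x0, t0)\<bar> \<le> (14 + 2 * real DIM('a)) * M / R"
proof -
  define w where "w = dir_deriv (b, 0) u"
  define eta where "eta = (\<lambda>z::'a \<times> real. R\<^sup>2 + (snd z - t0) - (norm (fst z - x0))\<^sup>2)"
  define N where "N = real DIM('a)"
  define L where "L = (14 + 2 * N) * R\<^sup>2"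
  define F where "F = (\<lambda>z. (eta z * w z)\<^sup>2 + L * (u z)\<^sup>2)"
  define D where "D = (cball x0 R \<times> {t0 - R\<^sup>2..t0}) \<inter> {z. 0 \<le> eta z}"
  have N: "N \<ge> 0" by (simp add: N_def)
  have D: "(x, t) \<in> D \<longleftrightarrow> t \<le> t0 \<and> 0 \<le> eta (x, t)" for x t
  proof -
    have "t0 - R\<^sup>2 \<le> t \<and> dist x0 x \<le> R" if "t \<le> t0" "0 \<le> eta (x, t)"
    proof -
      have "(norm (x - x0))\<^sup>2 \<le> R\<^sup>2 + (t - t0)" using that by (simp add: eta_def)
      moreover from this have "(norm (x - x0))\<^sup>2 \<le> R\<^sup>2" using that by simp
      moreover have "0 \<le> R\<^sup>2 + (t - t0)"
        using calculation(1) order_trans zero_le_power2 by blast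
      ultimately show ?thesis using R
        by (auto simp: dist_norm norm_minus_commute intro: power2_le_imp_le)
    qed
    then show ?thesis by (auto simp: D_def)
  qed
  have smooth: "smooth_on ancient_domain u" "smooth_on ancient_domain w"
    using u by (auto simp: w_def caloric_imp_smooth_on intro!: smooth_on_dir_deriv)
  have w: "caloric w" unfolding w_def using u by (rule caloric_dir_deriv)
  have "compact D" unfolding D_def
    by (intro compact_Int_closed compact_Times compact_cball compact_Icc closed_Collect_le)
      (auto simp: eta_def intro!: continuous_intros)
  moreover have center: "(x0, t0) \<in> D" using R by (auto simp: D eta_def)
  moreover have "D \<subseteq> ancient_domain" using t0 D by auto
  then have "continuous_on D u" "continuous_on D w"
    using smooth smooth_on_imp_continuous_on continuous_on_subset by blast+
  then have "continuous_on D F"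
    unfolding F_def eta_def by (intro continuous_intros)
  ultimately obtain z where z: "z \<in> D" "\<And>y. y \<in> D \<Longrightarrow> F y \<le> F z"
    using continuous_attains_sup[of D F] by blast
  obtain x t where xt: "z = (x, t)" by (cases z)
  have t: "t \<le> t0" "t \<le> 0" "eta z \<ge> 0" using z(1) t0 D xt by auto
  have "eta z * w z = 0"
  proof (rule ccontr)
    assume "eta z * w z \<noteq> 0"
    then have eta: "eta z > 0" and wz: "(w z)\<^sup>2 > 0" using t by auto
    define f1 f2 g2 where "f1 c = dir_deriv (c, 0) u z" and "f2 c = dir_deriv (c, 0) (dir_deriv (c, 0) u) z"
      and "g2 c = dir_deriv (c, 0) (dir_deriv (c, 0) w) z" for c :: 'a
    define ft gt where "ft = dir_deriv (0, 1) u z" and "gt = dir_deriv (0, 1) w z"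
    have space: "(eta z)\<^sup>2 * (w z * g2 c) + L * (u z * f2 c) + L * (f1 c)\<^sup>2
        \<le> 12 * (((x - x0) \<bullet> c)\<^sup>2 * (w z)\<^sup>2) + 2 * (eta z * (w z)\<^sup>2)" if c: "c \<in> Basis" for c
    proof -
      have line: "eta (x + s *\<^sub>R c, t) = eta z - 2 * ((x - x0) \<bullet> c) * s - s\<^sup>2" for s
      proof -
        have "(norm (x + s *\<^sub>R c - x0))\<^sup>2 = (x - x0 + s *\<^sub>R c) \<bullet> (x - x0 + s *\<^sub>R c)"
          by (simp add: power2_norm_eq_inner algebra_simps)
        also have "\<dots> = (norm (x - x0))\<^sup>2 + 2 * ((x - x0) \<bullet> c) * s + s\<^sup>2"
          using c by (simp add: inner_add_left inner_add_right inner_commute power2_norm_eq_inner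
              del: inner_diff_left inner_diff_right) (simp add: power2_eq_square)
        finally show ?thesis by (simp add: eta_def xt)
      qed
      have "((\<lambda>s. eta (x + s *\<^sub>R c, t)) \<longlongrightarrow> eta z) (at 0)"
        unfolding line by (auto intro!: tendsto_eq_intros)
      then have "eventually (\<lambda>s. eta (x + s *\<^sub>R c, t) > 0) (at 0)"
        using eta by (rule order_tendstoD)
      then obtain d where d: "d > 0" "\<And>s. s \<noteq> 0 \<Longrightarrow> \<bar>s\<bar> < d \<Longrightarrow> eta (x + s *\<^sub>R c, t) > 0"
        by (auto simp: eventually_at dist_real_def)
      have max: "F (x + s *\<^sub>R c, t) \<le> F (x + 0 *\<^sub>R c, t)" if "\<bar>s\<bar> < d" for s
        using z(2)[of "(x + s *\<^sub>R c, t)"] d(2)[of s] that t by (cases "s = 0") (auto simp: D xt)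
      have "(eta z)\<^sup>2 * (w (x + 0 *\<^sub>R c, t) * g2 c) + L * (u (x + 0 *\<^sub>R c, t) * f2 c)
          + L * (dir_deriv (c, 0) u (x + 0 *\<^sub>R c, t))\<^sup>2
        \<le> 12 * (((x - x0) \<bullet> c)\<^sup>2 * (w (x + 0 *\<^sub>R c, t))\<^sup>2) + 2 * (eta z * (w (x + 0 *\<^sub>R c, t))\<^sup>2)"
      proof (rule bernstein_line[OF dir_deriv_space[OF smooth(1) t(2)] _
            dir_deriv_space[OF smooth(2) t(2)] _ d(1)])
        show "((\<lambda>a. dir_deriv (c, 0) u (x + a *\<^sub>R c, t)) has_real_derivative f2 c) (at 0)"
          using dir_deriv_space[OF smooth_on_dir_deriv[OF smooth(1)] t(2), of _ x c 0]
          by (simp add: f2_def xt)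
        show "((\<lambda>a. dir_deriv (c, 0) w (x + a *\<^sub>R c, t)) has_real_derivative g2 c) (at 0)"
          using dir_deriv_space[OF smooth_on_dir_deriv[OF smooth(2)] t(2), of _ x c 0]
          by (simp add: g2_def xt)
      qed (use max in \<open>simp add: F_def line xt[symmetric]\<close>)
      then show ?thesis by (simp add: xt f1_def)
    qed
    have eta_line: "eta (x, r) = eta z + (r - t)" for r by (simp add: eta_def xt)
    have time_eta: "((\<lambda>r. eta (x, r)) has_real_derivative 1) (at t within {..0})"
      unfolding eta_line by (auto intro!: derivative_eq_intros)
    have "((\<lambda>r. F (x, r)) has_real_derivative
        2 * (eta z * w z) * (w z + eta z * gt) + 2 * L * (u z * ft)) (at t within {..0})"
      using bernstein_function_derivative[OF time_eta dir_deriv_time[OF smooth(1) t(2), of x]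
          dir_deriv_time[OF smooth(2) t(2), of x], of L]
      unfolding F_def ft_def gt_def xt by simp
    then have "0 \<le> 2 * (eta z * w z) * (w z + eta z * gt) + 2 * L * (u z * ft)"
    proof (rule derivative_nonneg_at_left_max[OF _ t(2) eta])
      show "F (x, s) \<le> F (x, t)" if "t - eta z < s" "s \<le> t" for s
        using z(2)[of "(x, s)"] that t by (auto simp: D eta_def xt)
    qed
    then have time: "0 \<le> eta z * (w z)\<^sup>2 + (eta z)\<^sup>2 * (w z * gt) + L * (u z * ft)"
      by (simp add: power2_eq_square algebra_simps)
    have heat: "ft = (\<Sum>c\<in>Basis. f2 c)" "gt = (\<Sum>c\<in>Basis. g2 c)"
      using u w t by (auto simp: ft_def gt_def f2_def g2_def caloric_def xt)
    \<comment> \<open>By the heat equation the second-order terms add up to time derivatives, which the inequality in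
      time bounds from below.\<close>
    have "(\<Sum>c\<in>Basis. (eta z)\<^sup>2 * (w z * g2 c) + L * (u z * f2 c) + L * (f1 c)\<^sup>2)
        \<le> (\<Sum>c\<in>Basis. 12 * (((x - x0) \<bullet> c)\<^sup>2 * (w z)\<^sup>2) + 2 * (eta z * (w z)\<^sup>2))"
      by (intro sum_mono space)
    then have "(eta z)\<^sup>2 * (w z * gt) + L * (u z * ft) + L * (\<Sum>c\<in>Basis. (f1 c)\<^sup>2)
        \<le> 12 * ((\<Sum>c\<in>Basis. ((x - x0) \<bullet> c)\<^sup>2) * (w z)\<^sup>2) + 2 * N * (eta z * (w z)\<^sup>2)"
      by (simp add: heat sum.distrib sum_distrib_left[symmetric] sum_distrib_right[symmetric] N_def)
    moreover have "(\<Sum>c\<in>Basis. ((x - x0) \<bullet> c)\<^sup>2) = (norm (x - x0))\<^sup>2"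
      unfolding power2_norm_eq_inner by (subst euclidean_inner) (simp add: power2_eq_square)
    moreover have "L * (w z)\<^sup>2 \<le> L * (\<Sum>c\<in>Basis. (f1 c)\<^sup>2)"
    proof (rule mult_left_mono)
      have "(f1 b)\<^sup>2 \<le> (\<Sum>c\<in>Basis. (f1 c)\<^sup>2)" by (rule member_le_sum) (use b in auto)
      then show "(w z)\<^sup>2 \<le> (\<Sum>c\<in>Basis. (f1 c)\<^sup>2)" by (simp add: f1_def w_def)
    qed (use N in \<open>simp add: L_def\<close>)
    ultimately have "L * (w z)\<^sup>2 \<le> (12 * (norm (x - x0))\<^sup>2 + (2 * N + 1) * eta z) * (w z)\<^sup>2"
      using time by (simp add: algebra_simps)
    then have "L \<le> 12 * (norm (x - x0))\<^sup>2 + (2 * N + 1) * eta z" using wz by simp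
    also have "\<dots> \<le> 12 * R\<^sup>2 + (2 * N + 1) * R\<^sup>2"
    proof (intro add_mono mult_left_mono)
      show "(norm (x - x0))\<^sup>2 \<le> R\<^sup>2" using t by (auto simp: eta_def xt)
      show "eta z \<le> R\<^sup>2"
        using t(1) zero_le_power2[of "norm (x - x0)"] unfolding eta_def xt fst_conv snd_conv by linarith
    qed (use N in auto)
    also have "\<dots> < L" using R by (simp add: L_def algebra_simps)
    finally show False by simp
  qed
  then have "F z = L * (u z)\<^sup>2" by (simp add: F_def)
  also have "\<dots> \<le> L * M\<^sup>2"
    using bound[of t x] t N unfolding L_def
    by (intro mult_left_mono) (auto simp: xt eta_def abs_le_square_iff[symmetric])
  finally have "F (x0, t0) \<le> L * M\<^sup>2" using z(2)[OF center] by simp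
  then have "R\<^sup>2 * (R * w (x0, t0))\<^sup>2 + L * (u (x0, t0))\<^sup>2 \<le> R\<^sup>2 * ((14 + 2 * N) * M\<^sup>2)"
    by (simp add: F_def eta_def L_def power2_eq_square algebra_simps)
  moreover have "L * (u (x0, t0))\<^sup>2 \<ge> 0" using N by (simp add: L_def)
  ultimately have "R\<^sup>2 * (R * w (x0, t0))\<^sup>2 \<le> R\<^sup>2 * ((14 + 2 * N) * M\<^sup>2)" by linarith
  then have "(R * w (x0, t0))\<^sup>2 \<le> (14 + 2 * N) * M\<^sup>2" using R by simp
  also have "\<dots> \<le> (14 + 2 * N) * (14 + 2 * N) * M\<^sup>2"
    using N by (intro mult_right_mono) auto
  finally have "(R * w (x0, t0))\<^sup>2 \<le> ((14 + 2 * N) * M)\<^sup>2"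
    by (simp add: power2_eq_square algebra_simps)
  moreover have "M \<ge> 0" using bound[of t0 x0] R by fastforce
  ultimately have "\<bar>R * w (x0, t0)\<bar> \<le> (14 + 2 * N) * M"
    using N abs_le_square_iff[of "R * w (x0, t0)" "(14 + 2 * N) * M"] by simp
  then show ?thesis using R by (simp add: w_def N_def field_simps abs_mult)
qed

section \<open>Polynomial growth and rigidity\<close>

text \<open>Growth of order \<open>m\<close> in the parabolic scaling, measured on cylinders centred at the origin.
  The exponent may be negative, which is what makes differentiation eventually produce zero.\<close>

definition growth :: "real \<Rightarrow> ('a::euclidean_space \<times> real \<Rightarrow> real) \<Rightarrow> bool" where
  "growth m u \<longleftrightarrow> (\<exists>C. \<forall>R\<ge>1. \<forall>x t. norm x \<le> R \<longrightarrow> - R\<^sup>2 \<le> t \<longrightarrow> t \<le> 0 \<longrightarrow>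
     \<bar>u (x, t)\<bar> \<le> C * R powr m)"

lemma growth_cong:
  assumes "growth m u" "\<And>z. z \<in> ancient_domain \<Longrightarrow> u z = w z"
  shows "growth m w"
proof -
  have "w (x, t) = u (x, t)" if "t \<le> 0" for x t using assms(2)[of "(x, t)"] that by simp
  then show ?thesis using assms(1) by (auto simp: growth_def)
qed

lemma growth_add:
  assumes "growth m u" "growth m w"
  shows "growth m (\<lambda>z. u z + w z)"
proof -
  obtain C D where "\<And>R x t. R \<ge> 1 \<Longrightarrow> norm x \<le> R \<Longrightarrow> - R\<^sup>2 \<le> t \<Longrightarrow> t \<le> 0 \<Longrightarrow> \<bar>u (x, t)\<bar> \<le> C * R powr m"
    "\<And>R x t. R \<ge> 1 \<Longrightarrow> norm x \<le> R \<Longrightarrow> - R\<^sup>2 \<le> t \<Longrightarrow> t \<le> 0 \<Longrightarrow> \<bar>w (x, t)\<bar> \<le> D * R powr m"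
    using assms unfolding growth_def by blast
  then show ?thesis unfolding growth_def
    by (intro exI[of _ "C + D"]) (auto simp: distrib_right intro!: abs_triangle_ineq[THEN order_trans] add_mono)
qed

lemma growth_const: "m \<ge> 0 \<Longrightarrow> growth m (\<lambda>z. c)"
  unfolding growth_def by (intro exI[of _ "\<bar>c\<bar>"]) (auto simp: ge_one_powr_ge_zero mult_le_cancel_left1)

lemma growth_mult:
  assumes "growth m u" "growth k w"
  shows "growth (m + k) (\<lambda>z. u z * w z)"
proof -
  obtain C D where *: "\<And>R x t. R \<ge> 1 \<Longrightarrow> norm x \<le> R \<Longrightarrow> - R\<^sup>2 \<le> t \<Longrightarrow> t \<le> 0 \<Longrightarrow> \<bar>u (x, t)\<bar> \<le> C * R powr m"
    "\<And>R x t. R \<ge> 1 \<Longrightarrow> norm x \<le> R \<Longrightarrow> - R\<^sup>2 \<le> t \<Longrightarrow> t \<le> 0 \<Longrightarrow> \<bar>w (x, t)\<bar> \<le> D * R powr k"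
    using assms unfolding growth_def by blast
  have "\<bar>u (x, t) * w (x, t)\<bar> \<le> (C * D) * R powr (m + k)"
    if "R \<ge> 1" "norm x \<le> R" "- R\<^sup>2 \<le> t" "t \<le> 0" for R x t
  proof -
    have "\<bar>u (x, t)\<bar> * \<bar>w (x, t)\<bar> \<le> (C * R powr m) * (D * R powr k)"
      using *(1)[OF that] by (intro mult_mono *[OF that]) auto
    then show ?thesis by (simp add: abs_mult powr_add algebra_simps)
  qed
  then show ?thesis unfolding growth_def by blast
qed

lemma growth_mono:
  assumes "growth m u" "m \<le> k"
  shows "growth k u"
proof -
  obtain C where C: "\<And>R x t. R \<ge> 1 \<Longrightarrow> norm x \<le> R \<Longrightarrow> - R\<^sup>2 \<le> t \<Longrightarrow> t \<le> 0 \<Longrightarrow> \<bar>u (x, t)\<bar> \<le> C * R powr m"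
    using assms unfolding growth_def by blast
  have C0: "C \<ge> 0" using C[of 1 0 0] by simp
  have "\<bar>u (x, t)\<bar> \<le> C * R powr k"
    if "R \<ge> 1" "norm x \<le> R" "- R\<^sup>2 \<le> t" "t \<le> 0" for R x t
    using C[OF that] mult_left_mono[OF powr_mono[OF assms(2) that(1)] C0] by linarith
  then show ?thesis unfolding growth_def by blast
qed

lemma growth_sum:
  assumes "finite I" "I \<noteq> {}" "\<And>i. i \<in> I \<Longrightarrow> growth m (u i)"
  shows "growth m (\<lambda>z. \<Sum>i\<in>I. u i z)"
  using assms by (induction I rule: finite_ne_induct) (auto intro: growth_add)

text \<open>The parabolic region of radius \<open>R\<close> below a point of the cylinder of radius \<open>R\<close> lies in
  the cylinder of radius \<open>2 R\<close>, so the gradient estimate costs a constant factor and gains \<open>1 / R\<close>.\<close>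

lemma growth_dir_deriv_space:
  fixes u :: "'a::euclidean_space \<times> real \<Rightarrow> real"
  assumes u: "caloric u" and g: "growth m u" and b: "b \<in> Basis"
  shows "growth (m - 1) (dir_deriv (b, 0) u)"
proof -
  obtain C where C: "\<And>R x t. R \<ge> 1 \<Longrightarrow> norm x \<le> R \<Longrightarrow> - R\<^sup>2 \<le> t \<Longrightarrow> t \<le> 0 \<Longrightarrow> \<bar>u (x, t)\<bar> \<le> C * R powr m"
    using g unfolding growth_def by blast
  define K where "K = 14 + 2 * real DIM('a)"
  have "\<bar>dir_deriv (b, 0) u (x, t)\<bar> \<le> K * C * 2 powr m * R powr (m - 1)"
    if R: "R \<ge> 1" and x: "norm x \<le> R" and t: "- R\<^sup>2 \<le> t" "t \<le> 0" for R x t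
  proof -
    have "\<bar>dir_deriv (b, 0) u (x, t)\<bar> \<le> K * (C * (2 * R) powr m) / R"
      unfolding K_def
    proof (rule gradient_estimate[OF u b t(2)])
      fix y :: 'a and s :: real
      assume s: "s \<le> t" "(norm (y - x))\<^sup>2 \<le> R\<^sup>2 + (s - t)"
      have "(norm (y - x))\<^sup>2 \<le> R\<^sup>2" using s by linarith
      then have "norm (y - x) \<le> R" by (rule power2_le_imp_le) (use R in simp)
      then have "norm y \<le> 2 * R" using norm_triangle_sub[of y x] x by linarith
      moreover have four: "(2 * R)\<^sup>2 = 4 * R\<^sup>2" by (simp add: power_mult_distrib)
      have "- (2 * R)\<^sup>2 \<le> s"
        using s(2) t zero_le_power2[of "norm (y - x)"] zero_le_power2[of R]
          four by linarith
      ultimately show "\<bar>u (y, s)\<bar> \<le> C * (2 * R) powr m"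
        using s(1) t R by (intro C) auto
    qed (use R in auto)
    also have "\<dots> = K * C * 2 powr m * R powr (m - 1)"
      using R by (simp add: powr_mult powr_diff)
    finally show ?thesis .
  qed
  then show ?thesis unfolding growth_def by blast
qed

text \<open>By the heat equation a time derivative is a sum of second space derivatives.\<close>

lemma growth_dir_deriv_time:
  fixes u :: "'a::euclidean_space \<times> real \<Rightarrow> real"
  assumes u: "caloric u" and g: "growth m u"
  shows "growth (m - 2) (dir_deriv (0, 1) u)"
proof -
  have "growth (m - 1 - 1) (\<lambda>z. \<Sum>b\<in>Basis. dir_deriv (b, 0) (dir_deriv (b, 0) u) z)"
    by (intro growth_sum growth_dir_deriv_space caloric_dir_deriv u g) auto
  then show ?thesis
    using growth_cong u unfolding caloric_def by (smt (verit, ccfv_SIG))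
qed

lemma growth_funpow_space:
  assumes "caloric u" "growth m u" "b \<in> Basis"
  shows "growth (m - real k) ((dir_deriv (b, 0) ^^ k) u)"
proof (induction k)
  case (Suc k)
  from growth_dir_deriv_space[OF caloric_funpow_dir_deriv[OF assms(1)] this assms(3)]
  show ?case by (simp add: algebra_simps)
qed (use assms in simp)

lemma growth_funpow_time:
  assumes "caloric u" "growth m u"
  shows "growth (m - 2 * real k) ((dir_deriv (0, 1) ^^ k) u)"
proof (induction k)
  case (Suc k)
  from growth_dir_deriv_time[OF caloric_funpow_dir_deriv[OF assms(1)] this]
  show ?case by (simp add: algebra_simps)
qed (use assms in simp)

lemma growth_neg_imp_zero:
  assumes "growth m u" "m < 0" "z \<in> ancient_domain"
  shows "u z = 0"
proof -
  obtain C where C: "\<And>R x t. R \<ge> 1 \<Longrightarrow> norm x \<le> R \<Longrightarrow> - R\<^sup>2 \<le> t \<Longrightarrow> t \<le> 0 \<Longrightarrow> \<bar>u (x, t)\<bar> \<le> C * R powr m"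
    using assms(1) unfolding growth_def by blast
  obtain x t where z: "z = (x, t)" "t \<le> 0" using assms(3) by (cases z) auto
  have "((\<lambda>R. C * R powr m) \<longlongrightarrow> C * 0) at_top"
    by (intro tendsto_mult tendsto_const tendsto_neg_powr assms filterlim_ident)
  moreover have "eventually (\<lambda>R. \<bar>u z\<bar> \<le> C * R powr m) at_top"
    using eventually_ge_at_top[of "max 1 (max (norm x) (- t))"]
  proof eventually_elim
    case (elim R)
    then have "R \<le> R\<^sup>2" by (intro self_le_power) auto
    then have "- R\<^sup>2 \<le> t" using elim by simp
    then show ?case using C[of R x t] elim z by simp
  qed
  ultimately have "\<bar>u z\<bar> \<le> C * 0" by (intro tendsto_lowerbound) auto
  then show ?thesis by simp
qed

lemma zero_if_initially_zero_and_stationary: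
  assumes u: "smooth_on ancient_domain u" and init: "\<And>x. u (x, 0) = 0"
    and stat: "\<And>z. z \<in> ancient_domain \<Longrightarrow> dir_deriv (0, 1) u z = 0" and z: "z \<in> ancient_domain"
  shows "u z = 0"
proof -
  obtain x t where xt: "z = (x, t)" "t \<le> 0" using z by (cases z) auto
  have "((\<lambda>r. u (x, r)) has_derivative (\<lambda>h. 0)) (at s within {t..0})" if "t \<le> s" "s \<le> 0" for s
    using DERIV_subset[OF dir_deriv_time[OF u that(2), of x], of "{t..0}"] stat[of "(x, s)"] that
    by (auto simp: has_field_derivative_def lambda_zero)
  from mvt_very_simple[OF xt(2) this] show ?thesis using init xt by auto
qed

text \<open>The value at \<open>t = 0\<close> determines a caloric function of polynomial growth. By the heat equation all time derivatives vanish at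
  \<open>t = 0\<close>; since high time derivatives vanish identically, integrating in time from the top order
  downwards kills all of them.\<close>

lemma caloric_zero_initial:
  fixes u :: "'a::euclidean_space \<times> real \<Rightarrow> real"
  assumes u: "caloric u" and g: "growth m u" and init: "\<And>x. u (x, 0) = 0"
    and z: "z \<in> ancient_domain"
  shows "u z = 0"
proof -
  let ?T = "dir_deriv (0, 1) :: ('a \<times> real \<Rightarrow> real) \<Rightarrow> _"
  have init': "(?T ^^ j) u (x, 0) = 0" for j x
  proof (induction j arbitrary: x)
    case (Suc j)
    have *: "dir_deriv (b, 0) w (x, 0) = 0"
      if "\<And>x. w (x, 0) = 0" "caloric w" for w and b x :: 'a
      using dir_deriv_space[OF caloric_imp_smooth_on[OF that(2)], of 0 x b 0] that(1)
      by (auto intro: DERIV_unique)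
    have w: "caloric ((?T ^^ j) u)" by (rule caloric_funpow_dir_deriv[OF u])
    then have "?T ((?T ^^ j) u) (x, 0)
        = (\<Sum>b\<in>Basis. dir_deriv (b, 0) (dir_deriv (b, 0) ((?T ^^ j) u)) (x, 0))"
      by (simp add: caloric_def)
    also have "\<dots> = 0" using Suc.IH w by (intro sum.neutral ballI * caloric_dir_deriv)
    finally show ?case by simp
  qed (use init in simp)
  obtain k where k: "m < real k" using reals_Archimedean2 by blast
  have "(?T ^^ k) u z = 0" if "z \<in> ancient_domain" for z
    by (rule growth_neg_imp_zero[OF growth_funpow_time[OF u g] _ that]) (use k in simp)
  then have "\<forall>z\<in>ancient_domain. u z = 0"
  proof (induction k)
    case (Suc k)
    have "(?T ^^ k) u z = 0" if "z \<in> ancient_domain" for z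
      by (rule zero_if_initially_zero_and_stationary[where u = "(?T ^^ k) u", OF _ init' _ that])
        (use Suc.prems in \<open>auto intro: caloric_imp_smooth_on caloric_funpow_dir_deriv u\<close>)
    then show ?case by (rule Suc.IH)
  qed simp
  with z show ?thesis by blast
qed

text \<open>Differentiating \<open>k > m\<close> times makes the growth exponent negative, so the Taylor expansion
  along a coordinate line stops before order \<open>k\<close>.\<close>

lemma polynomial_on_lines:
  fixes u :: "'a::euclidean_space \<times> real \<Rightarrow> real"
  assumes u: "caloric u" and g: "growth m u" and m: "m < real k" and k: "k > 0" and b: "b \<in> Basis"
  shows "\<exists>p :: real poly. degree p < k \<and> (\<forall>s. u (x + s *\<^sub>R b, 0) = poly p s)"
proof -
  define D where "D j s = (dir_deriv (b, 0) ^^ j) u (x + s *\<^sub>R b, 0)" for j s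
  have D: "\<forall>j s. (D j has_real_derivative D (Suc j) s) (at s)"
    unfolding D_def funpow.simps o_apply
    by (intro allI dir_deriv_space caloric_imp_smooth_on caloric_funpow_dir_deriv u) simp
  have Dk: "D k s = 0" for s
    unfolding D_def
    by (rule growth_neg_imp_zero[OF growth_funpow_space[OF u g b]]) (use m in auto)
  define p where "p = (\<Sum>j<k. monom (D j 0 / fact j) j)"
  have "degree p < k"
    unfolding p_def using k by (intro degree_sum_less) (auto intro: le_less_trans[OF degree_monom_le])
  moreover have "u (x + s *\<^sub>R b, 0) = poly p s" for s
  proof -
    obtain t where "D 0 s = (\<Sum>j<k. D j 0 / fact j * s ^ j) + D k t / fact k * s ^ k"
      using Maclaurin_all_le[OF refl D, of s k] by blast
    then show ?thesis by (simp add: Dk p_def poly_sum poly_monom) (simp add: D_def)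
  qed
  ultimately show ?thesis by blast
qed

definition grid :: "nat \<Rightarrow> 'a::euclidean_space set" where
  "grid k = {x. \<forall>b\<in>Basis. x \<bullet> b \<in> real ` {..<k}}"

text \<open>One coordinate at a time: if \<open>f\<close> vanishes wherever the coordinates outside \<open>B\<close> are grid values,
  then so it does after freeing one more coordinate, because a polynomial of degree below \<open>k\<close> with
  \<open>k\<close> roots is zero.\<close>

lemma zero_on_grid_imp_zero:
  fixes f :: "'a::euclidean_space \<Rightarrow> real"
  assumes lines: "\<And>b x. b \<in> Basis \<Longrightarrow> \<exists>p :: real poly. degree p < k \<and> (\<forall>s. f (x + s *\<^sub>R b) = poly p s)"
    and grid: "\<And>x. x \<in> grid k \<Longrightarrow> f x = 0"
  shows "f x = 0"
proof -
  have "\<forall>x. (\<forall>b\<in>Basis - B. x \<bullet> b \<in> real ` {..<k}) \<longrightarrow> f x = 0" if "finite B" "B \<subseteq> Basis" for B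
    using that
  proof (induction B rule: finite_induct)
    case empty
    then show ?case using grid by (auto simp: grid_def)
  next
    case (insert c B)
    show ?case
    proof (intro allI impI)
      fix x assume x: "\<forall>b\<in>Basis - insert c B. x \<bullet> b \<in> real ` {..<k}"
      from insert.prems have c: "c \<in> Basis" by simp
      obtain p :: "real poly" where p: "degree p < k" "\<And>s. f (x + s *\<^sub>R c) = poly p s"
        using lines[OF c] by blast
      have root: "poly p (real j - x \<bullet> c) = 0" if "j < k" for j
      proof -
        have "f (x + (real j - x \<bullet> c) *\<^sub>R c) = 0"
        proof (rule insert.IH[rule_format])
          fix b assume b: "b \<in> Basis - B"
          show "(x + (real j - x \<bullet> c) *\<^sub>R c) \<bullet> b \<in> real ` {..<k}"
            using x b c that by (cases "b = c") (auto simp: inner_add_left inner_not_same_Basis)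
        qed (use insert.prems in auto)
        then show ?thesis by (simp add: p(2))
      qed
      have "p = 0"
      proof (rule ccontr)
        assume "p \<noteq> 0"
        have "k = card ((\<lambda>j. real j - x \<bullet> c) ` {..<k})"
          by (subst card_image) (auto simp: inj_on_def)
        also have "\<dots> \<le> card {s. poly p s = 0}"
          using root \<open>p \<noteq> 0\<close> by (intro card_mono poly_roots_finite) auto
        also have "\<dots> \<le> degree p" using \<open>p \<noteq> 0\<close> by (rule card_poly_roots_bound)
        finally show False using p(1) by simp
      qed
      then show "f x = 0" using p(2)[of 0] by simp
    qed
  qed
  from this[of Basis] show ?thesis by simp
qed

lemma caloric_zero_on_grid:
  fixes u :: "'a::euclidean_space \<times> real \<Rightarrow> real"
  assumes u: "caloric u" and g: "growth m u" and m: "m < real k" and k: "k > 0"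
    and grid: "\<And>x. x \<in> grid k \<Longrightarrow> u (x, 0) = 0" and z: "z \<in> ancient_domain"
  shows "u z = 0"
proof (rule caloric_zero_initial[OF u g _ z])
  show "u (x, 0) = 0" for x
    using zero_on_grid_imp_zero[of k "\<lambda>x. u (x, 0)"] polynomial_on_lines[OF u g m k] grid by blast
qed

section \<open>The space of ancient caloric functions and the upper bound\<close>

lemma ancient_caloric_iff:
  fixes u :: "'a::euclidean_space \<times> real \<Rightarrow> real"
  shows "ancient_caloric u \<longleftrightarrow> caloric u"
proof (cases "smooth_on ancient_domain u")
  case True
  have lap: "laplacian (\<lambda>y. u (y, t)) x = (\<Sum>b\<in>Basis. dir_deriv (b, 0) (dir_deriv (b, 0) u) (x, t))"
    if t: "t \<le> 0" for x t
    unfolding laplacian_def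
  proof (rule sum.cong[OF refl])
    fix b :: 'a
    have "deriv (\<lambda>s. u (x + s *\<^sub>R b, t)) = (\<lambda>s. dir_deriv (b, 0) u (x + s *\<^sub>R b, t))"
      using dir_deriv_space[OF True t] by (auto intro!: DERIV_imp_deriv)
    moreover have "deriv (\<lambda>s. dir_deriv (b, 0) u (x + s *\<^sub>R b, t)) 0
        = dir_deriv (b, 0) (dir_deriv (b, 0) u) (x + 0 *\<^sub>R b, t)"
      by (intro DERIV_imp_deriv dir_deriv_space smooth_on_dir_deriv True t)
    ultimately show "(deriv ^^ 2) (\<lambda>s. u (x + s *\<^sub>R b, t)) 0
        = dir_deriv (b, 0) (dir_deriv (b, 0) u) (x, t)"
      by (simp add: numeral_2_eq_2)
  qed
  have time: "((\<lambda>s. u (x, s)) has_real_derivative l) (at t within {..0})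
      \<longleftrightarrow> dir_deriv (0, 1) u (x, t) = l" if t: "t \<le> 0" for x t l
  proof
    have "at t within {..0} \<noteq> bot"
    proof
      assume "at t within {..0} = bot"
      moreover have "at_left t \<le> at t within {..0}" using t by (intro at_le) auto
      ultimately have "at_left t = bot" using bot.extremum_uniqueI by metis
      then show False using trivial_limit_at_left_real[of t] by blast
    qed
    then show "dir_deriv (0, 1) u (x, t) = l"
      if "((\<lambda>s. u (x, s)) has_real_derivative l) (at t within {..0})"
      using vector_derivative_unique_within dir_deriv_time[OF True t, of x] that
      unfolding has_real_derivative_iff_has_vector_derivative by blast
  qed (use dir_deriv_time[OF True t, of x] in auto)
  show ?thesis
    using True by (auto simp: ancient_caloric_def caloric_def time lap)
qed (auto simp: ancient_caloric_def caloric_def)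

text \<open>Enlarging the radius absorbs the centre \<open>p\<close> of the balls into the constant.\<close>

lemma ancient_caloric_poly_iff:
  fixes u :: "'a::euclidean_space \<times> real \<Rightarrow> real"
  assumes d: "d \<ge> 0"
  shows "u \<in> ancient_caloric_poly d \<longleftrightarrow>
    (\<forall>z. z \<notin> ancient_domain \<longrightarrow> u z = 0) \<and> caloric u \<and> growth d u"
proof -
  have "growth d u" if *: "\<forall>R>0. \<forall>x\<in>ball p R. \<forall>t\<in>{-(R^2)..0}. \<bar>u (x, t)\<bar> \<le> C * (1 + R) powr d"
    for p C
  proof -
    have "\<bar>u (p, 0)\<bar> \<le> C * 2 powr d" using *[rule_format, of 1 p 0] by simp
    then have "0 \<le> C * 2 powr d" by linarith
    then have C: "C \<ge> 0" by (simp add: zero_le_mult_iff)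
    have "\<bar>u (x, t)\<bar> \<le> C * (3 + norm p) powr d * R powr d"
      if R: "R \<ge> 1" and x: "norm x \<le> R" and t: "- R\<^sup>2 \<le> t" "t \<le> 0" for R x t
    proof -
      let ?S = "R + norm p + 1"
      have S: "?S > 0" using R norm_ge_zero[of p] by linarith
      have "x \<in> ball p ?S" using x norm_triangle_ineq4[of p x] by (simp add: dist_norm)
      moreover have "R\<^sup>2 \<le> ?S\<^sup>2" using R by (intro power_mono) auto
      then have "t \<in> {- ?S\<^sup>2..0}" using t by simp
      ultimately have "\<bar>u (x, t)\<bar> \<le> C * (1 + ?S) powr d" using * S by blast
      also have "\<dots> \<le> C * ((3 + norm p) * R) powr d"
      proof (intro mult_left_mono powr_mono2 d C)
        have "norm p * 1 \<le> norm p * R" using R by (intro mult_left_mono) auto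
        then show "1 + ?S \<le> (3 + norm p) * R" using R by (simp add: algebra_simps)
      qed (use S in auto)
      also have "\<dots> = C * (3 + norm p) powr d * R powr d" using R by (simp add: powr_mult)
      finally show ?thesis .
    qed
    then show ?thesis unfolding growth_def by blast
  qed
  moreover have "\<exists>p C. \<forall>R>0. \<forall>x\<in>ball p R. \<forall>t\<in>{-(R^2)..0}. \<bar>u (x, t)\<bar> \<le> C * (1 + R) powr d"
    if g: "growth d u"
  proof -
    obtain C where C: "\<And>R x t. R \<ge> 1 \<Longrightarrow> norm x \<le> R \<Longrightarrow> - R\<^sup>2 \<le> t \<Longrightarrow> t \<le> 0 \<Longrightarrow> \<bar>u (x, t)\<bar> \<le> C * R powr d"
      using g unfolding growth_def by blast
    have "\<bar>u (x, t)\<bar> \<le> C * (1 + R) powr d" if "R > 0" "x \<in> ball 0 R" "t \<in> {- R\<^sup>2..0}" for R x t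
    proof -
      have "R\<^sup>2 \<le> (1 + R)\<^sup>2" using that by (intro power_mono) auto
      then have "- (1 + R)\<^sup>2 \<le> t" using that(3) unfolding atLeastAtMost_iff by linarith
      then show ?thesis using that by (intro C) auto
    qed
    then show ?thesis by blast
  qed
  ultimately show ?thesis unfolding ancient_caloric_poly_def ancient_caloric_iff by blast
qed

lemma caloric_lincomb:
  fixes u w :: "'a::euclidean_space \<times> real \<Rightarrow> real"
  assumes u: "caloric u" and w: "caloric w"
  shows "caloric (\<lambda>z. u z + c * w z)"
proof -
  note smooth = caloric_imp_smooth_on[OF u] caloric_imp_smooth_on[OF w]
    smooth_on_dir_deriv smooth_on_add smooth_on_mult smooth_on_const
  have "dir_deriv (b, 0) (dir_deriv (b, 0) (\<lambda>z. u z + c * w z)) z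
      = dir_deriv (b, 0) (dir_deriv (b, 0) u) z + c * dir_deriv (b, 0) (dir_deriv (b, 0) w) z"
    if z: "z \<in> ancient_domain" for z and b :: 'a
  proof -
    have "dir_deriv (b, 0) (dir_deriv (b, 0) (\<lambda>z. u z + c * w z)) z
        = dir_deriv (b, 0) (\<lambda>z. dir_deriv (b, 0) u z + c * dir_deriv (b, 0) w z) z"
      by (rule dir_deriv_cong[OF z]) (intro smooth dir_deriv_lincomb; assumption)+
    also have "\<dots> = dir_deriv (b, 0) (dir_deriv (b, 0) u) z + c * dir_deriv (b, 0) (dir_deriv (b, 0) w) z"
      by (intro dir_deriv_lincomb smooth z)
    finally show ?thesis .
  qed
  moreover have "dir_deriv (0, 1) (\<lambda>z. u z + c * w z) z
      = dir_deriv (0, 1) u z + c * dir_deriv (0, 1) w z" if "z \<in> ancient_domain" for z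
    by (intro dir_deriv_lincomb smooth that)
  moreover have "smooth_on ancient_domain (\<lambda>z. u z + c * w z)" by (intro smooth)
  ultimately show ?thesis
    using u w by (simp add: caloric_def sum.distrib sum_distrib_left)
qed

lemma caloric_cong:
  fixes u w :: "'a::euclidean_space \<times> real \<Rightarrow> real"
  assumes u: "caloric u" and eq: "\<And>z. z \<in> ancient_domain \<Longrightarrow> u z = w z"
  shows "caloric w"
proof -
  note smooth = caloric_imp_smooth_on[OF u] smooth_on_dir_deriv
  have first: "dir_deriv v u z = dir_deriv v w z" if "z \<in> ancient_domain" for v z
    using that smooth(1) eq by (rule dir_deriv_cong)
  have second: "dir_deriv v (dir_deriv v u) z = dir_deriv v (dir_deriv v w) z"
    if "z \<in> ancient_domain" for v z
    using that smooth(2)[OF smooth(1)] first by (rule dir_deriv_cong)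
  from first second show ?thesis
    using u smooth_on_cong[OF smooth(1)] eq by (simp add: caloric_def)
qed

lemma caloric_zero: "caloric (\<lambda>z. 0)"
proof -
  have *: "dir_deriv v (\<lambda>z. 0) z = 0" if "z \<in> ancient_domain" for v z :: "'a \<times> real"
    using that by (rule dir_deriv_eqI) simp
  have "dir_deriv v (dir_deriv v (\<lambda>z. 0)) z = 0" if "z \<in> ancient_domain" for v z :: "'a \<times> real"
    using dir_deriv_cong[OF that smooth_on_dir_deriv[OF smooth_on_const], of v 0 "\<lambda>z. 0" v] * that by simp
  with * show ?thesis by (auto simp: caloric_def smooth_on_const)
qed

lemma subspace_ancient_caloric_poly:
  assumes "d \<ge> 0"
  shows "subspace (ancient_caloric_poly d :: ('a::euclidean_space \<times> real \<Rightarrow> real) set)"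
proof -
  have lin: "(\<lambda>z. u z + c * w z) \<in> ancient_caloric_poly d"
    if "u \<in> ancient_caloric_poly d" "w \<in> ancient_caloric_poly d" for u w :: "'a \<times> real \<Rightarrow> real" and c
  proof -
    have "growth (0 + d) (\<lambda>z. c * w z)"
      using that assms by (intro growth_mult growth_const) (auto simp: ancient_caloric_poly_iff)
    then show ?thesis using that assms
      by (auto simp: ancient_caloric_poly_iff intro!: caloric_lincomb growth_add)
  qed
  have zero: "(\<lambda>z. 0) \<in> (ancient_caloric_poly d :: ('a \<times> real \<Rightarrow> real) set)"
    using assms by (simp add: ancient_caloric_poly_iff caloric_zero growth_const)
  show ?thesis
    unfolding subspace_def
    using lin[of _ _ 1] lin[OF zero] zero
    by (auto simp: zero_fun_def plus_fun_def scaleR_fun_def)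
qed

lemma grid_eq_image:
  "(grid k :: 'a::euclidean_space set)
    = (\<lambda>f. \<Sum>b\<in>Basis. real (f b) *\<^sub>R b) ` (\<Pi>\<^sub>E b\<in>Basis. {..<k})"
proof (intro equalityI subsetI)
  fix x :: 'a assume x: "x \<in> grid k"
  define f where "f = (\<lambda>b\<in>Basis. SOME j. j < k \<and> x \<bullet> b = real j)"
  have "f b < k \<and> x \<bullet> b = real (f b)" if "b \<in> Basis" for b
    using someI_ex[of "\<lambda>j. j < k \<and> x \<bullet> b = real j"] x that by (auto simp: f_def grid_def)
  then have "f \<in> (\<Pi>\<^sub>E b\<in>Basis. {..<k})" "x = (\<Sum>b\<in>Basis. real (f b) *\<^sub>R b)"
    by (auto simp: f_def intro!: euclidean_eqI[of x])
  then show "x \<in> (\<lambda>f. \<Sum>b\<in>Basis. real (f b) *\<^sub>R b) ` (\<Pi>\<^sub>E b\<in>Basis. {..<k})" by blast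
qed (auto simp: grid_def PiE_def Pi_def)

lemma finite_grid: "finite (grid k :: 'a::euclidean_space set)"
  unfolding grid_eq_image by (intro finite_imageI finite_PiE) auto

lemma card_grid: "card (grid k :: 'a::euclidean_space set) = k ^ DIM('a)"
proof -
  have "inj_on (\<lambda>f. \<Sum>b\<in>Basis. real (f b) *\<^sub>R (b::'a)) (\<Pi>\<^sub>E b\<in>Basis. {..<k})"
  proof (rule inj_onI)
    fix f g assume fg: "f \<in> (\<Pi>\<^sub>E b\<in>(Basis::'a set). {..<k})" "g \<in> (\<Pi>\<^sub>E b\<in>(Basis::'a set). {..<k})"
      and eq: "(\<Sum>b\<in>Basis. real (f b) *\<^sub>R (b::'a)) = (\<Sum>b\<in>Basis. real (g b) *\<^sub>R b)"
    show "f = g"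
    proof (rule PiE_ext[OF fg])
      fix b :: 'a assume b: "b \<in> Basis"
      have "(\<Sum>c\<in>Basis. real (f c) *\<^sub>R c) \<bullet> b = (\<Sum>c\<in>Basis. real (g c) *\<^sub>R c) \<bullet> b"
        by (simp only: eq)
      then show "f b = g b" using b by simp
    qed
  qed
  then show ?thesis unfolding grid_eq_image by (simp add: card_image card_PiE)
qed

lemma sum_fun_apply: "(\<Sum>i\<in>I. f i) x = (\<Sum>i\<in>I. f i x)"
  by (induction I rule: infinite_finite_induct) (auto simp: plus_fun_def zero_fun_def)

lemma card_le_of_grid_support:
  fixes B :: "('a::euclidean_space \<Rightarrow> real) set"
  assumes "independent B" and supp: "\<And>f x. f \<in> B \<Longrightarrow> x \<notin> grid k \<Longrightarrow> f x = 0"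
  shows "finite B \<and> card B \<le> k ^ DIM('a)"
proof -
  define e where "e = (\<lambda>(y::'a) x. if x = y then 1 else 0 :: real)"
  let ?E = "e ` (grid k :: 'a set)"
  have "B \<subseteq> span ?E"
  proof
    fix f assume f: "f \<in> B"
    have "f = (\<Sum>y\<in>grid k. f y *\<^sub>R e y)"
    proof
      fix x
      have "(\<Sum>y\<in>grid k. f y *\<^sub>R e y) x = (\<Sum>y\<in>grid k. if x = y then f y else 0)"
        by (simp add: sum_fun_apply scaleR_fun_def e_def if_distrib cong: if_cong)
      then show "f x = (\<Sum>y\<in>grid k. f y *\<^sub>R e y) x"
        using supp[OF f, of x] by (auto simp: sum.delta'[OF finite_grid])
    qed
    also have "\<dots> \<in> span ?E" by (intro span_sum span_scale span_base) auto
    finally show "f \<in> span ?E" .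
  qed
  then have "finite B \<and> card B \<le> card ?E"
    by (intro independent_span_bound assms finite_imageI finite_grid)
  then show ?thesis using card_image_le[OF finite_grid, of e k] by (simp add: card_grid)
qed

text \<open>Evaluation at time \<open>0\<close> on the grid is linear, and injective by \<open>caloric_zero_on_grid\<close>, so
  the dimension is at most the number of grid points.\<close>

lemma ancient_caloric_poly_finite_basis:
  fixes d :: real
  assumes d: "d \<ge> 0" and k: "d < real k"
  obtains B :: "('a::euclidean_space \<times> real \<Rightarrow> real) set" where
    "B \<subseteq> ancient_caloric_poly d" "independent B" "ancient_caloric_poly d \<subseteq> span B"
    "finite B" "card B \<le> k ^ DIM('a)" "card B = dim (ancient_caloric_poly d :: ('a \<times> real \<Rightarrow> real) set)"
proof -
  let ?V = "ancient_caloric_poly d :: ('a \<times> real \<Rightarrow> real) set"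
  obtain B where B: "B \<subseteq> ?V" "independent B" "?V \<subseteq> span B" "card B = dim ?V"
    by (rule basis_exists)
  have V: "subspace ?V" using d by (rule subspace_ancient_caloric_poly)
  have span: "span B = ?V" using B(1,3) V by (simp add: span_minimal subset_antisym)
  define ev where "ev = (\<lambda>(u :: 'a \<times> real \<Rightarrow> real) x. if x \<in> grid k then u (x, 0) else 0)"
  have ev: "linear ev"
    by (rule linearI) (auto simp: ev_def plus_fun_def scaleR_fun_def fun_eq_iff)
  have inj: "inj_on ev ?V"
    unfolding linear_inj_on_iff_eq_0[OF ev V]
  proof (intro ballI impI)
    fix u assume u: "u \<in> ?V" "ev u = 0"
    have "u (x, 0) = 0" if "x \<in> grid k" for x
      using fun_cong[OF u(2), of x] that by (simp add: ev_def zero_fun_def)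
    then have "u z = 0" for z
      using caloric_zero_on_grid[of u d k z] u(1) k d
      by (cases z; cases "z \<in> ancient_domain") (auto simp: ancient_caloric_poly_iff)
    then show "u = 0" by (auto simp: zero_fun_def)
  qed
  have "independent (ev ` B)"
    using linear_independent_injective_image[OF ev B(2)] inj span by simp
  then have "finite (ev ` B) \<and> card (ev ` B) \<le> k ^ DIM('a)"
    by (rule card_le_of_grid_support) (auto simp: ev_def)
  moreover have "inj_on ev B" using inj B(1) inj_on_subset by blast
  ultimately have fin: "finite B" "card B \<le> k ^ DIM('a)"
    by (auto simp: card_image finite_image_iff)
  show thesis by (rule that[OF B(1-3) fin B(4)])
qed

section \<open>Caloric extensions of polynomials and the lower bound\<close>

text \<open>The exponential series of \<open>t d\<^sup>2/ds\<^sup>2\<close> applied to \<open>p\<close>. All further terms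
  are zero when \<open>degree p \<le> m\<close>, and then this is the caloric extension of \<open>p\<close>.\<close>

definition heat_poly :: "nat \<Rightarrow> real poly \<Rightarrow> real \<Rightarrow> real \<Rightarrow> real" where
  "heat_poly m p s t = (\<Sum>j\<le>m. t ^ j / fact j * poly ((pderiv ^^ (2 * j)) p) s)"

lemma degree_funpow_pderiv: "degree ((pderiv ^^ n) (p :: real poly)) = degree p - n"
  by (induction n) (auto simp: degree_pderiv)

lemma funpow_pderiv_eq_0: "degree (p :: real poly) < n \<Longrightarrow> (pderiv ^^ n) p = 0"
proof (induction n)
  case (Suc n)
  have "degree ((pderiv ^^ n) p) = 0" using Suc.prems by (simp add: degree_funpow_pderiv)
  then show ?case by (auto elim!: degree_eq_zeroE simp: pderiv_pCons)
qed simp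

lemma heat_poly_initial: "heat_poly m p s 0 = poly p s"
proof -
  have "heat_poly m p s 0 = (\<Sum>j\<le>m. if j = 0 then poly p s else 0)"
    unfolding heat_poly_def by (rule sum.cong) auto
  then show ?thesis by (simp add: sum.delta)
qed

lemma heat_poly_space_derivative:
  "((\<lambda>s. heat_poly m p s t) has_real_derivative heat_poly m (pderiv p) s t) (at s)"
  unfolding heat_poly_def funpow_swap1[symmetric]
  by (auto intro!: derivative_eq_intros poly_DERIV simp: mult.commute)

lemma heat_poly_time_derivative:
  assumes "degree p \<le> m"
  shows "(heat_poly m p s has_real_derivative heat_poly m (pderiv (pderiv p)) s t) (at t)"
proof -
  let ?a = "\<lambda>j. poly ((pderiv ^^ (2 * j)) p) s"
  have "((\<lambda>t. \<Sum>j\<le>m. t ^ j / fact j * ?a j) has_real_derivative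
      (\<Sum>j\<le>m. real j * t ^ (j - 1) / fact j * ?a j)) (at t)"
    by (auto intro!: derivative_eq_intros)
  also have "(\<Sum>j\<le>m. real j * t ^ (j - 1) / fact j * ?a j) = heat_poly m (pderiv (pderiv p)) s t"
  proof -
    have "(\<Sum>j\<le>m. real j * t ^ (j - 1) / fact j * ?a j)
        = (\<Sum>j<m. real (Suc j) * t ^ j / fact (Suc j) * ?a (Suc j))"
      by (simp add: lessThan_Suc_atMost[symmetric] sum.lessThan_Suc_shift del: sum.lessThan_Suc)
    also have "\<dots> = (\<Sum>j<m. t ^ j / fact j * poly ((pderiv ^^ (2 * j)) (pderiv (pderiv p))) s)"
    proof (rule sum.cong[OF refl])
      fix j
      have "(pderiv ^^ (2 * Suc j)) p = (pderiv ^^ (2 * j)) (pderiv (pderiv p))"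
        by (simp add: funpow_swap1)
      then show "real (Suc j) * t ^ j / fact (Suc j) * ?a (Suc j)
          = t ^ j / fact j * poly ((pderiv ^^ (2 * j)) (pderiv (pderiv p))) s"
        by (simp add: fact_Suc del: of_nat_Suc funpow.simps)
    qed
    also have "\<dots> = heat_poly m (pderiv (pderiv p)) s t"
    proof -
      have "(pderiv ^^ (2 * m)) (pderiv (pderiv p)) = (pderiv ^^ Suc (Suc (2 * m))) p"
        by (simp add: funpow_swap1)
      also have "\<dots> = 0" using assms by (intro funpow_pderiv_eq_0) simp
      finally show ?thesis by (simp add: heat_poly_def lessThan_Suc_atMost[symmetric])
    qed
    finally show ?thesis .
  qed
  finally show ?thesis unfolding heat_poly_def .
qed

lemma growth_power: "growth m u \<Longrightarrow> growth (real n * m) (\<lambda>z. u z ^ n)"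
proof (induction n)
  case (Suc n)
  then have "growth (m + real n * m) (\<lambda>z. u z * u z ^ n)" by (intro growth_mult) auto
  then show ?case by (simp add: algebra_simps)
qed (simp add: growth_const)

lemma growth_prod:
  assumes "finite I" "\<And>i. i \<in> I \<Longrightarrow> growth m (u i)"
  shows "growth (real (card I) * m) (\<lambda>z. \<Prod>i\<in>I. u i z)"
  using assms
proof (induction I rule: finite_induct)
  case (insert i I)
  then have "growth (m + real (card I) * m) (\<lambda>z. u i z * (\<Prod>i\<in>I. u i z))"
    by (intro growth_mult) auto
  then show ?case using insert.hyps by (simp add: algebra_simps)
qed (simp add: growth_const)

lemma growth_coordinate:
  assumes "b \<in> Basis"
  shows "growth 1 (\<lambda>z. fst z \<bullet> b)"
  unfolding growth_def using Basis_le_norm[OF assms] order_trans by (intro exI[of _ 1]) fastforce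

lemma growth_time: "growth 2 snd"
  unfolding growth_def by (intro exI[of _ 1]) auto

lemma growth_poly_coordinate:
  assumes b: "b \<in> Basis"
  shows "growth (real (degree p)) (\<lambda>z. poly p (fst z \<bullet> b))"
proof -
  have "growth (real (degree p)) (\<lambda>z. coeff p i * (fst z \<bullet> b) ^ i)" if "i \<le> degree p" for i
  proof -
    have "growth (0 + real i * 1) (\<lambda>z. coeff p i * (fst z \<bullet> b) ^ i)"
      by (intro growth_mult growth_const growth_power growth_coordinate b) simp
    then show ?thesis by (rule growth_mono) (use that in simp)
  qed
  then show ?thesis unfolding poly_altdef by (intro growth_sum) auto
qed

text \<open>In parabolic scaling \<open>t ^ j\<close> has order \<open>2 j\<close>, exactly what the \<open>2 j\<close> derivatives of \<open>p\<close> take away.\<close>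

lemma growth_heat_poly:
  assumes b: "b \<in> Basis" and p: "degree p \<le> m"
  shows "growth (real m) (\<lambda>z. heat_poly m p (fst z \<bullet> b) (snd z))"
proof -
  have "growth (real m) (\<lambda>z. snd z ^ j / fact j * poly ((pderiv ^^ (2 * j)) p) (fst z \<bullet> b))" for j
  proof (cases "2 * j \<le> degree p")
    case True
    let ?q = "(pderiv ^^ (2 * j)) p"
    have "growth (0 + (real j * 2 + real (degree ?q)))
        (\<lambda>z. 1 / fact j * (snd z ^ j * poly ?q (fst z \<bullet> b)))"
      by (intro growth_mult growth_const growth_power growth_time growth_poly_coordinate b) simp
    then have "growth (real m) (\<lambda>z. 1 / fact j * (snd z ^ j * poly ?q (fst z \<bullet> b)))"
      by (rule growth_mono) (use True p in \<open>simp add: degree_funpow_pderiv of_nat_diff\<close>)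
    then show ?thesis by simp
  next
    case False
    then show ?thesis by (simp add: funpow_pderiv_eq_0 growth_const)
  qed
  then show ?thesis unfolding heat_poly_def by (intro growth_sum) auto
qed

lemma smooth_on_heat_poly: "smooth_on S (\<lambda>z. heat_poly m p (fst z \<bullet> b) (snd z))"
proof -
  have "smooth_on S (\<lambda>z. fst z \<bullet> b)" "smooth_on S snd"
    by (auto intro!: smooth_on_bounded_linear bounded_linear_intros)
  then have "smooth_on S (\<lambda>z. \<Sum>j\<le>m. (snd z ^ j * (1 / fact j)) * poly ((pderiv ^^ (2 * j)) p) (fst z \<bullet> b))"
    by (intro smooth_on_sum smooth_on_mult smooth_on_power smooth_on_const smooth_on_poly)
  then show ?thesis by (simp add: heat_poly_def)
qed

definition heat_product :: "nat \<Rightarrow> ('a \<Rightarrow> real poly) \<Rightarrow> 'a::euclidean_space \<times> real \<Rightarrow> real" where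
  "heat_product m P z = (if z \<in> ancient_domain
     then \<Prod>b\<in>Basis. heat_poly m (P b) (fst z \<bullet> b) (snd z) else 0)"

text \<open>Products of one-dimensional caloric functions in different coordinates are caloric by the
  product rule, as each factor satisfies its own heat equation.\<close>

lemma heat_product_in_ancient_caloric_poly:
  fixes P :: "'a::euclidean_space \<Rightarrow> real poly"
  assumes P: "\<And>b. b \<in> Basis \<Longrightarrow> degree (P b) \<le> m"
  shows "heat_product m P \<in> ancient_caloric_poly (real DIM('a) * real m)"
proof -
  define u where "u = (\<lambda>z. \<Prod>b\<in>Basis. heat_poly m (P b) (fst z \<bullet> b) (snd z))"
  let ?L = "\<lambda>x t. \<Sum>b\<in>Basis. heat_poly m (pderiv (pderiv (P b))) (x \<bullet> b) t
      * (\<Prod>c\<in>Basis - {b}. heat_poly m (P c) (x \<bullet> c) t)"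
  have "growth (real (card (Basis :: 'a set)) * real m) u"
    unfolding u_def by (intro growth_prod growth_heat_poly P) auto
  then have growth: "growth (real DIM('a) * real m) u" by simp
  have time: "((\<lambda>s. u (x, s)) has_real_derivative ?L x t) (at t within {..0})" for x t
    unfolding u_def fst_conv snd_conv
    by (rule has_field_derivative_at_within)
      (intro has_field_derivative_prod heat_poly_time_derivative P)
  have laplace: "laplacian (\<lambda>y. u (y, t)) x = ?L x t" for x t
    unfolding laplacian_def
  proof (rule sum.cong[OF refl])
    fix b :: 'a assume b: "b \<in> Basis"
    let ?K = "\<Prod>c\<in>Basis - {b}. heat_poly m (P c) (x \<bullet> c) t"
    have "u (x + s *\<^sub>R b, t) = heat_poly m (P b) (x \<bullet> b + s) t * ?K" for s
    proof -
      have "(x + s *\<^sub>R b) \<bullet> c = x \<bullet> c" if "c \<in> Basis - {b}" for c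
        using that b by (auto simp: inner_add_left inner_not_same_Basis)
      then have "(\<Prod>c\<in>Basis - {b}. heat_poly m (P c) ((x + s *\<^sub>R b) \<bullet> c) t) = ?K"
        by (intro prod.cong) auto
      then show ?thesis
        using b by (simp add: u_def prod.remove[OF finite_Basis b] inner_add_left)
    qed
    moreover have d: "deriv (\<lambda>s. heat_poly m q (x \<bullet> b + s) t * ?K)
        = (\<lambda>s. heat_poly m (pderiv q) (x \<bullet> b + s) t * ?K)" for q
    proof
      fix s
      have "((\<lambda>s. heat_poly m q (x \<bullet> b + s) t) has_real_derivative
          heat_poly m (pderiv q) (x \<bullet> b + s) t * 1) (at s)"
        by (rule DERIV_chain2[OF heat_poly_space_derivative]) (auto intro!: derivative_eq_intros)
      from DERIV_cmult_right[OF this, of ?K]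
      show "deriv (\<lambda>s. heat_poly m q (x \<bullet> b + s) t * ?K) s
          = heat_poly m (pderiv q) (x \<bullet> b + s) t * ?K"
        by (intro DERIV_imp_deriv) simp
    qed
    ultimately show "(deriv ^^ 2) (\<lambda>s. u (x + s *\<^sub>R b, t)) 0
        = heat_poly m (pderiv (pderiv (P b))) (x \<bullet> b) t * ?K"
      by (simp add: numeral_2_eq_2)
  qed
  have "smooth_on ancient_domain u"
    unfolding u_def by (intro smooth_on_prod smooth_on_heat_poly)
  with time laplace have "caloric u"
    unfolding ancient_caloric_iff[symmetric] ancient_caloric_def by auto
  moreover have "u z = heat_product m P z" if "z \<in> ancient_domain" for z
    using that by (simp add: u_def heat_product_def)
  ultimately have "caloric (heat_product m P) \<and> growth (real DIM('a) * real m) (heat_product m P)"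
    using caloric_cong growth_cong[OF growth] by blast
  then show ?thesis by (simp add: ancient_caloric_poly_iff heat_product_def)
qed

definition lagrange_poly :: "nat \<Rightarrow> real \<Rightarrow> real poly" where
  "lagrange_poly m r = (\<Prod>j\<in>{j. j \<le> m \<and> real j \<noteq> r}. [:- real j / (r - real j), 1 / (r - real j):])"

lemma degree_lagrange_poly:
  assumes "r \<in> real ` {..<Suc m}"
  shows "degree (lagrange_poly m r) \<le> m"
proof -
  obtain i where i: "r = real i" "i \<le> m" using assms by auto
  let ?J = "{j. j \<le> m \<and> real j \<noteq> r}"
  have "degree (lagrange_poly m r) \<le> (\<Sum>j\<in>?J. degree [:- real j / (r - real j), 1 / (r - real j):])"
    unfolding lagrange_poly_def by (rule degree_prod_sum_le[unfolded o_def]) auto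
  also have "\<dots> \<le> (\<Sum>j\<in>?J. 1)" by (intro sum_mono) (simp add: degree_pCons_le)
  also have "?J = {..m} - {i}" using i by auto
  finally show ?thesis using i by simp
qed

lemma poly_lagrange_poly:
  assumes "r \<in> real ` {..<Suc m}" "s \<in> real ` {..<Suc m}"
  shows "poly (lagrange_poly m r) s = (if s = r then 1 else 0)"
proof (cases "s = r")
  case True
  have "poly [:- real j / (r - real j), 1 / (r - real j):] r = 1" if "real j \<noteq> r" for j
    using that diff_divide_distrib[of r "real j" "r - real j"] by simp
  with True show ?thesis by (simp add: lagrange_poly_def poly_prod)
next
  case False
  obtain i where i: "s = real i" "i \<le> m" using assms(2) by auto
  have "finite {j. j \<le> m \<and> real j \<noteq> r}" by simp
  moreover have "poly [:- real i / (r - real i), 1 / (r - real i):] s = 0" using i by simp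
  ultimately show ?thesis
    using False i by (auto simp: lagrange_poly_def poly_prod intro!: prod_zero)
qed

text \<open>The caloric extensions of the tensor products of Lagrange polynomials are dual to the
  evaluations at the points of a grid, hence linearly independent.\<close>

lemma ancient_caloric_poly_large_independent:
  obtains S :: "('a::euclidean_space \<times> real \<Rightarrow> real) set" where
    "S \<subseteq> ancient_caloric_poly (real DIM('a) * real m)" "independent S" "card S = Suc m ^ DIM('a)"
proof
  define u where "u = (\<lambda>y. heat_product m (\<lambda>b::'a. lagrange_poly m (y \<bullet> b)))"
  have dual: "u y (x, 0) = (if x = y then 1 else 0)" if "y \<in> grid (Suc m)" "x \<in> grid (Suc m)" for x y
  proof -
    have "u y (x, 0) = (\<Prod>b\<in>Basis. if x \<bullet> b = y \<bullet> b then 1 else 0)"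
      unfolding u_def heat_product_def using that
      by (auto simp: heat_poly_initial grid_def poly_lagrange_poly intro!: prod.cong)
    also have "\<dots> = (if x = y then 1 else 0)"
      by (auto simp: euclidean_eq_iff[of x y] intro!: prod_zero)
    finally show ?thesis .
  qed
  have inj: "inj_on u (grid (Suc m))"
    by (rule inj_onI) (metis dual zero_neq_one)
  show "u ` grid (Suc m) \<subseteq> ancient_caloric_poly (real DIM('a) * real m)"
    unfolding u_def grid_def
    by (auto intro!: heat_product_in_ancient_caloric_poly degree_lagrange_poly)
  show "card (u ` grid (Suc m)) = Suc m ^ DIM('a)"
    using inj by (simp add: card_image card_grid)
  show "independent (u ` grid (Suc m))"
    unfolding independent_explicit_module
  proof (intro allI impI)
    fix T c v assume T: "finite T" "T \<subseteq> u ` grid (Suc m)" "(\<Sum>v\<in>T. c v *\<^sub>R v) = 0" "v \<in> T"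
    then obtain y where y: "y \<in> grid (Suc m)" "v = u y" by auto
    have val: "w (y, 0) = (if w = v then 1 else 0)" if w: "w \<in> T" for w
    proof -
      obtain x where "x \<in> grid (Suc m)" "w = u x" using w T(2) by blast
      then show ?thesis using y dual inj by (auto simp: inj_on_eq_iff)
    qed
    have "(\<Sum>w\<in>T. c w * w (y, 0)) = (\<Sum>w\<in>T. if w = v then c w else 0)"
      by (rule sum.cong[OF refl]) (simp add: val)
    moreover have "(\<Sum>w\<in>T. c w * w (y, 0)) = 0"
      using fun_cong[OF T(3), of "(y, 0)"] by (simp add: sum_fun_apply scaleR_fun_def zero_fun_def)
    ultimately show "c v = 0" using T(1,4) by (simp add: sum.delta)
  qed
qed

lemma ancient_caloric_poly_mono:
  assumes "0 \<le> d" "d \<le> e"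
  shows "ancient_caloric_poly d \<subseteq> ancient_caloric_poly e"
  using assms growth_mono by (auto simp: ancient_caloric_poly_iff)

theorem mainTheorem4:
  shows "\<exists>c::real. c > 0 \<and> (\<forall>d::real. d \<ge> 1 \<longrightarrow>
    finite_dimensional (ancient_caloric_poly d :: ((real ^ 'n) \<times> real \<Rightarrow> real) set) \<and>
    inverse c * d ^ CARD('n) \<le> real (dim (ancient_caloric_poly d :: ((real ^ 'n) \<times> real \<Rightarrow> real) set)) \<and>
    real (dim (ancient_caloric_poly d :: ((real ^ 'n) \<times> real \<Rightarrow> real) set)) \<le> c * d ^ CARD('n))"
proof -
  let ?n = "CARD('n)"
  let ?V = "\<lambda>d. ancient_caloric_poly d :: ((real ^ 'n) \<times> real \<Rightarrow> real) set"
  have n: "?n \<ge> 1" by (simp add: Suc_leI)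
  \<comment> \<open>The factor \<open>2 ^ n\<close> serves the upper bound, where the grid has at most \<open>2 d\<close> points per direction;
    \<open>n ^ n\<close> serves the lower bound, where each of the \<open>n\<close> factors may have degree \<open>d / n\<close>.\<close>
  define c where "c = (2 * real ?n) ^ ?n"
  have c: "c > 0" "2 ^ ?n \<le> c" "real ?n ^ ?n \<le> c"
    using n by (auto simp: c_def intro!: power_mono)
  have "finite_dimensional (?V d) \<and> inverse c * d ^ ?n \<le> real (dim (?V d))
      \<and> real (dim (?V d)) \<le> c * d ^ ?n" if d: "d \<ge> 1" for d
  proof -
    \<comment> \<open>The least natural number above \<open>d\<close>, and the largest degree per coordinate whose \<open>n\<close>-fold product stays within order \<open>d\<close>.\<close>
    define k where "k = nat \<lfloor>d\<rfloor> + 1"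
    define m where "m = nat \<lfloor>d / real ?n\<rfloor>"
    have k: "d < real k" "real k \<le> 2 * d" using d by (auto simp: k_def) linarith+
    have m: "real m \<le> d / real ?n" "d / real ?n \<le> real (Suc m)"
      using d n by (auto simp: m_def) linarith+
    have dimension: "DIM(real ^ 'n) = ?n" by simp
    have d0: "d \<ge> 0" using d by simp
    obtain B where B: "B \<subseteq> ?V d" "independent B" "?V d \<subseteq> span B" "finite B"
        "card B \<le> k ^ ?n" "card B = dim (?V d)"
      by (rule ancient_caloric_poly_finite_basis[OF d0 k(1), where 'a = "real ^ 'n", unfolded dimension])
    obtain S where S: "S \<subseteq> ?V (real ?n * real m)" "independent S" "card S = Suc m ^ ?n"
      by (rule ancient_caloric_poly_large_independent[of m, where 'a = "real ^ 'n", unfolded dimension])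
    have "real ?n * real m \<le> d" using m(1) n by (simp add: field_simps)
    then have "S \<subseteq> span B" using S(1) B(3) ancient_caloric_poly_mono[of "real ?n * real m" d] by fastforce
    then have "card S \<le> card B" using independent_span_bound[OF B(4) S(2)] by simp
    then have "real (Suc m) ^ ?n \<le> real (dim (?V d))"
      unfolding B(6)[symmetric] S(3) of_nat_power[symmetric] by (rule of_nat_mono)
    moreover have "(d / real ?n) ^ ?n \<le> real (Suc m) ^ ?n" using m(2) d by (intro power_mono) auto
    moreover have "inverse c * d ^ ?n \<le> inverse (real ?n ^ ?n) * d ^ ?n"
      using c n d by (intro mult_right_mono le_imp_inverse_le) auto
    moreover have "inverse (real ?n ^ ?n) * d ^ ?n = (d / real ?n) ^ ?n"
      by (simp add: power_divide field_simps)
    ultimately have lower: "inverse c * d ^ ?n \<le> real (dim (?V d))" by linarith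
    have "real (dim (?V d)) \<le> real k ^ ?n"
      using B(5,6) by (metis of_nat_le_iff of_nat_power)
    also have "\<dots> \<le> (2 * d) ^ ?n" using k(2) by (intro power_mono) auto
    also have "\<dots> \<le> c * d ^ ?n"
      unfolding power_mult_distrib using c(2) d by (intro mult_right_mono) auto
    finally have "real (dim (?V d)) \<le> c * d ^ ?n" .
    with lower B(3,4) show ?thesis unfolding finite_dimensional_def by blast
  qed
  with c(1) show ?thesis by blast
qed

end
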